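(* Let $N\ge 1$, $D_1>0$, $D_2>0$, $0<p\le q$ with $pq>1$, and $0<T<\infty$. Let $(u,v)$ be a solution in $\mathbf{R}^N\times(0,T)$ to the system $$\partial_t u=D_1\Delta u+v^p,\qquad \partial_t v=D_2\Delta v+u^q,\qquad u,v\ge 0\qquad\text{in }\mathbf{R}^N\times(0,T),$$ and let $(\mu,\nu)$ be a pair of Radon measures in $\mathbf{R}^N$ such that $$\operatorname*{ess\,lim}_{t\to+0}\int_{\mathbf{R}^N}u(y,t)\phi(y)\,dy=\int_{\mathbf{R}^N}\phi\,d\mu,\qquad \operatorname*{ess\,lim}_{t\to+0}\int_{\mathbf{R}^N}v(y,t)\phi(y)\,dy=\int_{\mathbf{R}^N}\phi\,d\nu$$ for all $\phi\in C_0(\mathbf{R}^N)$. Then there exist positive constants $\gamma_B,\gamma_C,\gamma_D,\gamma_E$ depending only on $N$, $D_1$, $D_2$, $p$ and $q$ such that the following hold. (1) If $\frac{q+1}{pq-1}=\frac N2$ and $p<q$, then $$\sup_{x\in\mathbf{R}^N}\int_0^\sigma\tau^{-1}\left[\frac{\mu(B(x,\tau))}{\tau^{N-\frac{2(p+1)}{pq-1}}}\right]^q d\tau+\sup_{x\in\mathbf{R}^N}\nu(B(x,\sigma))\le\gamma_B\left[\log\left(e+\frac{T^{1/2}}{\sigma}\right)\right]^{-\frac{1}{pq-1}}$$ for $0<\sigma\le T^{1/2}$. (2) If $\frac{q+1}{pq-1}=\frac N2$ and $p=q$, then $$\sup_{x\in\mathbf{R}^N}\mu(B(x,\sigma))+\sup_{x\in\mathbf{R}^N}\nu(B(x,\sigma))\le\gamma_C\left[\log\left(e+\frac{T^{1/2}}{\sigma}\right)\right]^{-\frac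 N2}$$ for $0<\sigma\le T^{1/2}$. (3) If $\frac{q+1}{pq-1}>\frac N2$ and $q>1+\frac2N$, then $$\sup_{x\in\mathbf{R}^N}\int_0^{T^{1/2}}\tau^{-1}\left[\frac{\mu(B(x,\tau))}{\tau^{N-\frac{N+2}{q}}}\right]^q d\tau+\sup_{x\in\mathbf{R}^N}\nu(B(x,T^{1/2}))\le\gamma_D\,T^{\frac N2-\frac{q+1}{pq-1}}.$$ (4) If $\frac{q+1}{pq-1}>\frac N2$ and $q=1+\frac2N$, then $$\sup_{x\in\mathbf{R}^N}\int_0^{T^{1/2}}\tau^{-1}\mu(B(x,\tau))^q\,d\tau+\sup_{x\in\mathbf{R}^N}\nu(B(x,T^{1/2}))\le\gamma_E\,T^{\frac N2-\frac{q+1}{pq-1}}.$$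
   Context: Radon measures are nonnegative. $B(x,r)$ is the ball of center $x$ and radius $r$ in $\mathbf{R}^N$. $C_0(\mathbf{R}^N)$ is the space of continuous functions with compact support. $\operatorname{ess\,lim}_{t\to+0}$ is the limit as $t\to+0$ outside a null set of times. Let $G(x,t)=(4\pi t)^{-N/2}\exp(-|x|^2/(4t))$; for a Radon measure $\mu$ set $[S(t)\mu](x)=\int_{\mathbf{R}^N}G(x-y,t)\,d\mu(y)$, and for a nonnegative measurable function $\mu$ set $[S(t)\mu](x)=\int_{\mathbf{R}^N}G(x-y,t)\mu(y)\,dy$. Definition of solution: a pair $(u,v)$ of nonnegative measurable functions in $\mathbf{R}^N\times(0,T)$ is a solution to the system in $\mathbf{R}^N\times(0,T)$ if $u(x,t)<\infty$, $v(x,t)<\infty$ and $$u(x,t)=[S(D_1(t-\tau))u(\tau)](x)+\int_\tau^t[S(D_1(t-s))v(s)^p](x)\,ds,$$ $$v(x,t)=[S(D_2(t-\tau))v(\tau)](x)+\int_\tau^t[S(D_2(t-s))u(s)^q](x)\,ds$$ for almost all $x\in\mathbf{R}^N$ and $0<\tau<t<T$. *)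

theory Defs
  imports "HOL-Analysis.Analysis"
begin

text \<open>Real powers of extended nonnegative reals, for exponents \<open>a > 0\<close> only
  (so that \<open>\<infinity>\<close> is sent to \<open>\<infinity>\<close> and \<open>0\<close> to \<open>0\<close>).\<close>

definition ennpowr :: "ennreal \<Rightarrow> real \<Rightarrow> ennreal" where
  "ennpowr x a = (if x = \<infinity> then \<infinity> else ennreal (enn2real x powr a))"

definition heat_kernel :: "'a::euclidean_space \<Rightarrow> real \<Rightarrow> real" where
  "heat_kernel x t = (4 * pi * t) powr (- real DIM('a) / 2) * exp (- (norm x)\<^sup>2 / (4 * t))"

definition heat_semigroup :: "real \<Rightarrow> ('a::euclidean_space \<Rightarrow> ennreal) \<Rightarrow> 'a \<Rightarrow> ennreal" where
  "heat_semigroup t f x = (\<integral>\<^sup>+ y. ennreal (heat_kernel (x - y) t) * f y \<partial>lebesgue)"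

text \<open>``Almost all'' refers jointly to \<open>(x, \<tau>, t)\<close>, respectively to \<open>(x, t)\<close> in the finiteness
  condition. For measurable \<open>u\<close> and \<open>v\<close>, this is implied, by Fubini, by the requirement that for all
  \<open>0 < \<tau> < t < T\<close> the conditions hold for almost all \<open>x\<close>.\<close>

definition is_solution ::
  "real \<Rightarrow> real \<Rightarrow> real \<Rightarrow> real \<Rightarrow> real \<Rightarrow> ('a::euclidean_space \<Rightarrow> real \<Rightarrow> ennreal)
    \<Rightarrow> ('a \<Rightarrow> real \<Rightarrow> ennreal) \<Rightarrow> bool" where
  "is_solution D1 D2 p q T u v \<longleftrightarrow>
     (\<lambda>(x, t). u x t) \<in> borel_measurable (lebesgue_on (UNIV \<times> {0<..<T})) \<and>
     (\<lambda>(x, t). v x t) \<in> borel_measurable (lebesgue_on (UNIV \<times> {0<..<T})) \<and>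
     (AE (x, t) in lebesgue. 0 < t \<and> t < T \<longrightarrow> u x t < \<infinity> \<and> v x t < \<infinity>) \<and>
     (AE (x, \<tau>, t) in lebesgue. 0 < \<tau> \<and> \<tau> < t \<and> t < T \<longrightarrow>
        u x t = heat_semigroup (D1 * (t - \<tau>)) (\<lambda>y. u y \<tau>) x
              + (\<integral>\<^sup>+ s\<in>{\<tau><..<t}. heat_semigroup (D1 * (t - s)) (\<lambda>y. ennpowr (v y s) p) x \<partial>lebesgue) \<and>
        v x t = heat_semigroup (D2 * (t - \<tau>)) (\<lambda>y. v y \<tau>) x
              + (\<integral>\<^sup>+ s\<in>{\<tau><..<t}. heat_semigroup (D2 * (t - s)) (\<lambda>y. ennpowr (u y s) q) x \<partial>lebesgue))"

text \<open>A locally finite Borel measure on a Euclidean space is automatically inner and outer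
  regular.\<close>

definition radon_measure :: "'a::euclidean_space measure \<Rightarrow> bool" where
  "radon_measure \<mu> \<longleftrightarrow> sets \<mu> = sets borel \<and> (\<forall>K. compact K \<longrightarrow> emeasure \<mu> K < \<infinity>)"

definition compactly_supported_continuous :: "('a::euclidean_space \<Rightarrow> real) set" where
  "compactly_supported_continuous =
     {\<phi>. continuous_on UNIV \<phi> \<and> compact (closure {x. \<phi> x \<noteq> 0})}"

text \<open>The essential limit, as \<open>t\<close> tends to \<open>0\<close> from the right, of the integrals of
  \<open>w(\<cdot>, t) \<phi>\<close> is the integral of \<open>\<phi>\<close> with respect to \<open>\<mu>\<close>. The existence of the integrals for
  almost all small \<open>t > 0\<close> is required explicitly, because a Bochner integral has the value \<open>0\<close>
  when the integrand is not integrable. The conversion to real numbers is harmless for functions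
  that are finite almost everywhere.\<close>

definition has_initial_trace ::
  "('a::euclidean_space \<Rightarrow> real \<Rightarrow> ennreal) \<Rightarrow> 'a measure \<Rightarrow> bool" where
  "has_initial_trace w \<mu> \<longleftrightarrow>
     (\<forall>\<phi>\<in>compactly_supported_continuous. \<exists>Z. negligible Z \<and>
        (\<forall>\<^sub>F t in at 0 within ({0<..} - Z). integrable lebesgue (\<lambda>y. enn2real (w y t) * \<phi> y)) \<and>
        ((\<lambda>t. \<integral>y. enn2real (w y t) * \<phi> y \<partial>lebesgue) \<longlongrightarrow> (\<integral>y. \<phi> y \<partial>\<mu>))
          (at 0 within ({0<..} - Z)))"

end

theory Submission
  imports Defs
begin

text \<open>Everything follows from lower bounds that propagate along Duhamel's formula and would make
  the solution infinite if the initial data were too large. Write \<open>N\<close> for the dimension and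
  \<open>b = (q + 1) / (p q - 1)\<close>.

  Suppose that \<open>v \<ge> m\<close> on a ball of radius \<open>r\<close> during a time interval of length \<open>L \<le> r\<^sup>2\<close>. The
  heat semigroup loses at most a constant factor on the ball in such times, so after a waiting
  time \<open>\<theta>\<close> one has \<open>u \<ge> c m\<^sup>p \<theta>\<close> there, and after another \<open>\<theta>\<close> one has
  \<open>v \<ge> c (m\<^sup>p \<theta>)\<^sup>q \<theta>\<close>. Iterating with waiting times that decrease geometrically, \<open>m\<close>
  is replaced repeatedly by \<open>c m powr (p q) \<theta> powr (q + 1)\<close>, and since \<open>p q > 1\<close> this diverges
  in finite time unless \<open>m \<le> C L powr (- b)\<close> (\<open>fixed_ball_bound\<close>).

  The natural way to compare different times is a profile of heat-kernel type,
  \<open>v \<ge> m t powr (- N/2)\<close> on the ball of radius \<open>sqrt t\<close>; \<open>m\<close> is then the mass that has been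
  collected. The fixed-ball bound at time of order \<open>T\<close> gives \<open>m \<le> C T powr (N/2 - b)\<close>
  (\<open>mass_bound\<close>).

  The initial data feed such a profile from time \<open>\<sigma>\<^sup>2 / 16\<close> on in two ways. First, \<open>m\<close> may be a
  multiple of \<open>\<nu> (ball z \<sigma>)\<close> (\<open>initial_mass_lower_bound\<close>). Secondly,
  \<open>u \<ge> c s powr (- N/2) \<mu> (ball z (8 sqrt s))\<close> on the ball of radius \<open>sqrt s\<close>, so the source
  \<open>u\<^sup>q\<close> deposits in \<open>v\<close> a mass that after the substitution \<open>s = \<tau>\<^sup>2 / 64\<close> is, up to a
  constant factor, the weighted integral of \<open>\<mu> (ball z \<tau>)\<^sup>q\<close>
  (\<open>initial_source_lower_bound\<close>). With \<open>\<sigma> = sqrt T\<close> this proves the third and the fourth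
  assertion.

  In the critical case \<open>b = N/2\<close> the bound on \<open>m\<close> does not depend on \<open>T\<close>, and more is true: the
  exponents are such that the mass gained by \<open>v\<close> from the source \<open>u\<^sup>q\<close> is an integral of
  \<open>ds / s\<close>. Hence in logarithmic time \<open>l\<close> the mass \<open>m\<close> becomes \<open>c m powr (p q) l\<close>
  (\<open>critical_mass_bound\<close>), and for \<open>p = q\<close> both components gain logarithmically, so that it
  becomes \<open>c m powr (q q) l powr (q + 1)\<close> (\<open>critical_mass_bound_equal_exponents\<close>). The
  logarithmic time needed to double \<open>m\<close> is a multiple of a negative power of \<open>m\<close>, so all
  doublings together take a logarithmic time comparable with the first one
  (\<open>doubling_iteration\<close>). As \<open>m\<close> must stay bounded up to time \<open>T / 2\<close>, this total is at least of
  order \<open>ln (T / \<sigma>\<^sup>2)\<close>, which bounds \<open>m\<close> by a negative power of the logarithm. Inserting the two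
  profiles above gives the first assertion; the second one uses only the profiles generated by
  balls, for \<open>v\<close> and, after exchanging the two equations, for \<open>u\<close>.\<close>

section \<open>Lebesgue measure and integrals\<close>

lemma AE_lebesgue_iff_negligible:
  fixes P :: "'a::euclidean_space \<Rightarrow> bool"
  shows "(AE x in lebesgue. P x) \<longleftrightarrow> negligible {x. \<not> P x}"
proof
  assume "AE x in lebesgue. P x"
  then obtain S where "S \<in> null_sets lebesgue" "{x. \<not> P x} \<subseteq> S"
    by (auto simp: eventually_ae_filter)
  then show "negligible {x. \<not> P x}"
    by (meson negligible_iff_null_sets negligible_subset)
next
  assume "negligible {x. \<not> P x}"
  then show "AE x in lebesgue. P x"
    by (intro AE_I'[of "{x. \<not> P x}"]) (auto simp: negligible_iff_null_sets)
qed

lemma AE_lebesgue_pair: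
  fixes P :: "'a::euclidean_space \<times> 'b::euclidean_space \<Rightarrow> bool"
  assumes "AE z in lebesgue. P z"
  shows "AE x in lebesgue. AE y in lebesgue. P (x, y)"
proof -
  have "AE z in lborel \<Otimes>\<^sub>M lborel. P z"
    using assms unfolding AE_completion_iff lborel_prod .
  then have "AE x in lborel. AE y in lborel. P (x, y)"
    by (rule lborel_pair.AE_pair)
  then show ?thesis
    by (simp add: AE_completion_iff)
qed

text
  \<open>A differentiable map between spaces of the same dimension maps negligible sets to negligible sets. The use made of this is to reorder the coordinates of a product before applying Fubini's theorem in the form of the preceding lemma.\<close>

lemma AE_lebesgue_differentiable_preimage:
  fixes P :: "'a::euclidean_space \<Rightarrow> bool" and f :: "'a \<Rightarrow> 'b::euclidean_space"
  assumes "AE x in lebesgue. P x" and "DIM('a) = DIM('b)" and "f differentiable_on UNIV"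
    and "\<And>y. f (g y) = y"
  shows "AE y in lebesgue. P (g y)"
proof -
  have "negligible (f ` {x. \<not> P x})"
  proof (rule negligible_differentiable_image_negligible)
    show "DIM('a) \<le> DIM('b)" using assms by simp
    show "negligible {x. \<not> P x}" using assms(1) by (simp add: AE_lebesgue_iff_negligible)
    show "f differentiable_on {x. \<not> P x}"
      using assms(3) differentiable_on_subset by blast
  qed
  moreover have "{y. \<not> P (g y)} \<subseteq> f ` {x. \<not> P x}"
  proof
    fix y assume "y \<in> {y. \<not> P (g y)}"
    then show "y \<in> f ` {x. \<not> P x}" using assms(4)[of y] by (intro image_eqI[of _ _ "g y"]) auto
  qed
  ultimately show ?thesis
    unfolding AE_lebesgue_iff_negligible by (rule negligible_subset)
qed

lemma AE_lebesgue_obtain_in_open: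
  fixes P :: "'a::euclidean_space \<Rightarrow> bool"
  assumes "AE x in lebesgue. P x" and "open U" and "U \<noteq> {}"
  shows "\<exists>x\<in>U. P x"
proof (rule ccontr)
  assume "\<not> (\<exists>x\<in>U. P x)"
  then have "U \<subseteq> {x. \<not> P x}" by auto
  then have "negligible U"
    using assms(1) negligible_subset unfolding AE_lebesgue_iff_negligible by blast
  then show False using assms open_not_negligible by blast
qed

text
  \<open>Monotone convergence along the exhausting intervals, applied to the simple functions below an arbitrary integrand.\<close>

lemma nn_integral_greaterThanLessThan_le:
  fixes f :: "real \<Rightarrow> ennreal"
  assumes "\<And>n. (\<integral>\<^sup>+s\<in>{a + 1 / real (Suc n)<..<b}. f s \<partial>lebesgue) \<le> C"
  shows "(\<integral>\<^sup>+s\<in>{a<..<b}. f s \<partial>lebesgue) \<le> C"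
  unfolding nn_integral_def[of _ "\<lambda>s. f s * indicator {a<..<b} s"]
proof (rule SUP_least, clarify)
  fix g assume g: "simple_function lebesgue g" "g \<le> (\<lambda>s. f s * indicator {a<..<b} s)"
  define A where "A n = {a + 1 / real (Suc n)<..<b}" for n
  have gm: "g \<in> borel_measurable lebesgue" using g(1) by (rule borel_measurable_simple_function)
  have inc: "incseq (\<lambda>n s. g s * indicator (A n) s)"
  proof (rule incseq_SucI)
    fix n
    have "1 / real (Suc (Suc n)) \<le> 1 / real (Suc n)" by (simp add: field_simps)
    then show "(\<lambda>s. g s * indicator (A n) s) \<le> (\<lambda>s. g s * indicator (A (Suc n)) s)"
      by (auto simp: le_fun_def A_def split: split_indicator)
  qed
  have sup: "(SUP n. g s * indicator (A n) s) = g s" for s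
  proof (cases "a < s \<and> s < b")
    case True
    then obtain n where "1 / real (Suc n) < s - a"
      using nat_approx_posE[of "s - a"] by (metis diff_gt_0_iff_gt)
    then have n: "s \<in> A n" using True by (auto simp: A_def)
    show ?thesis
    proof (rule antisym)
      show "(SUP n. g s * indicator (A n) s) \<le> g s"
        by (rule SUP_least) (auto split: split_indicator)
      have "g s = g s * indicator (A n) s" using n by simp
      also have "\<dots> \<le> (SUP n. g s * indicator (A n) s)" by (rule SUP_upper) simp
      finally show "g s \<le> (SUP n. g s * indicator (A n) s)" .
    qed
  next
    case False
    have "g s \<le> f s * indicator {a<..<b} s" using g(2) by (simp add: le_fun_def)
    then have "g s = 0" using False by simp
    then show ?thesis by simp
  qed
  have "integral\<^sup>S lebesgue g = (\<integral>\<^sup>+s. g s \<partial>lebesgue)"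
    using g(1) by (simp add: nn_integral_eq_simple_integral)
  also have "\<dots> = (\<integral>\<^sup>+s. (SUP n. g s * indicator (A n) s) \<partial>lebesgue)" by (simp add: sup)
  also have "\<dots> = (SUP n. \<integral>\<^sup>+s. g s * indicator (A n) s \<partial>lebesgue)"
    by (intro nn_integral_monotone_convergence_SUP inc borel_measurable_times_ennreal gm
        borel_measurable_indicator) (simp add: A_def)
  also have "\<dots> \<le> C"
  proof (rule SUP_least)
    fix n
    have "(\<integral>\<^sup>+s. g s * indicator (A n) s \<partial>lebesgue) \<le> (\<integral>\<^sup>+s\<in>A n. f s \<partial>lebesgue)"
    proof (rule nn_integral_mono)
      fix s
      have "g s \<le> f s * indicator {a<..<b} s" using g(2) by (simp add: le_fun_def)
      then show "g s * indicator (A n) s \<le> f s * indicator (A n) s"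
        by (auto split: split_indicator_asm split: split_indicator)
    qed
    also have "\<dots> \<le> C" using assms[of n] by (simp add: A_def)
    finally show "(\<integral>\<^sup>+s. g s * indicator (A n) s \<partial>lebesgue) \<le> C" .
  qed
  finally show "integral\<^sup>S lebesgue g \<le> C" .
qed

lemma ennpowr_mono: "a > 0 \<Longrightarrow> x \<le> y \<Longrightarrow> ennpowr x a \<le> ennpowr y a"
  unfolding ennpowr_def
  by (auto simp: top_unique intro!: ennreal_leI powr_mono2 enn2real_mono simp: less_top)

lemma ennpowr_ennreal: "r \<ge> 0 \<Longrightarrow> ennpowr (ennreal r) a = ennreal (r powr a)"
  by (simp add: ennpowr_def)

section \<open>Supersolutions and Duhamel's formula\<close>

definition lower_bound_on_balls ::
  "'a::euclidean_space \<Rightarrow> real \<Rightarrow> real \<Rightarrow> (real \<Rightarrow> real) \<Rightarrow> (real \<Rightarrow> real) \<Rightarrow> ('a \<Rightarrow> real \<Rightarrow> ennreal) \<Rightarrow> bool"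
  where "lower_bound_on_balls z a T \<rho> g w \<longleftrightarrow>
    (AE t in lebesgue. a < t \<and> t < T \<longrightarrow> (AE x in lebesgue. x \<in> ball z (\<rho> t) \<longrightarrow> ennreal (g t) \<le> w x t))"

text \<open>Finiteness of \<open>u\<close>, and the part of its integral equation that the argument uses: both
  terms on the right are nonnegative, so each of them is a lower bound. The symmetric form in
  \<open>(D, p, u, v)\<close> allows the two equations to be handled by the same lemmas. The quantifiers are
  nested with \<open>t\<close> outermost, since a lower bound for \<open>u\<close> at almost every time is what the next
  application of Duhamel's formula needs.\<close>

definition supersolution ::
  "real \<Rightarrow> real \<Rightarrow> real \<Rightarrow> ('a::euclidean_space \<Rightarrow> real \<Rightarrow> ennreal) \<Rightarrow> ('a \<Rightarrow> real \<Rightarrow> ennreal) \<Rightarrow> bool"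
  where "supersolution D p T u v \<longleftrightarrow>
    (AE t in lebesgue. 0 < t \<and> t < T \<longrightarrow> (AE x in lebesgue. u x t < \<infinity> \<and>
      (AE \<tau> in lebesgue. 0 < \<tau> \<and> \<tau> < t \<longrightarrow>
        heat_semigroup (D * (t - \<tau>)) (\<lambda>y. u y \<tau>) x \<le> u x t \<and>
        (\<integral>\<^sup>+s\<in>{\<tau><..<t}. heat_semigroup (D * (t - s)) (\<lambda>y. ennpowr (v y s) p) x \<partial>lebesgue) \<le> u x t)))"

lemma solution_imp_supersolution:
  fixes u v :: "'a::euclidean_space \<Rightarrow> real \<Rightarrow> ennreal"
  assumes "is_solution D1 D2 p q T u v"
  shows "supersolution D1 p T u v" and "supersolution D2 q T v u"
proof -
  have "AE (x, t) in lebesgue. 0 < t \<and> t < T \<longrightarrow> u x t < \<infinity> \<and> v x t < \<infinity>"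
    using assms by (simp add: is_solution_def)
  then have "AE (t, x) in lebesgue. 0 < t \<and> t < T \<longrightarrow> u x t < \<infinity> \<and> v x t < \<infinity>"
    by (rule AE_lebesgue_differentiable_preimage[where f = "\<lambda>(x, t). (t, x)" and g = "\<lambda>(t, x). (x, t)",
          THEN eventually_mono])
       (auto simp: split_def intro!: linear_imp_differentiable_on bounded_linear.linear
         bounded_linear_intros)
  then have fin: "AE t in lebesgue. AE x in lebesgue. 0 < t \<and> t < T \<longrightarrow> u x t < \<infinity> \<and> v x t < \<infinity>"
    by (auto dest: AE_lebesgue_pair)
  let ?P = "\<lambda>x \<tau> t. 0 < \<tau> \<and> \<tau> < t \<and> t < T \<longrightarrow>
        heat_semigroup (D1 * (t - \<tau>)) (\<lambda>y. u y \<tau>) x \<le> u x t \<and>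
        (\<integral>\<^sup>+s\<in>{\<tau><..<t}. heat_semigroup (D1 * (t - s)) (\<lambda>y. ennpowr (v y s) p) x \<partial>lebesgue) \<le> u x t \<and>
        heat_semigroup (D2 * (t - \<tau>)) (\<lambda>y. v y \<tau>) x \<le> v x t \<and>
        (\<integral>\<^sup>+s\<in>{\<tau><..<t}. heat_semigroup (D2 * (t - s)) (\<lambda>y. ennpowr (u y s) q) x \<partial>lebesgue) \<le> v x t"
  have "AE (x, \<tau>, t) in lebesgue. ?P x \<tau> t"
  proof -
    have "AE (x, \<tau>, t) in lebesgue. 0 < \<tau> \<and> \<tau> < t \<and> t < T \<longrightarrow>
        u x t = heat_semigroup (D1 * (t - \<tau>)) (\<lambda>y. u y \<tau>) x
              + (\<integral>\<^sup>+s\<in>{\<tau><..<t}. heat_semigroup (D1 * (t - s)) (\<lambda>y. ennpowr (v y s) p) x \<partial>lebesgue) \<and>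
        v x t = heat_semigroup (D2 * (t - \<tau>)) (\<lambda>y. v y \<tau>) x
              + (\<integral>\<^sup>+s\<in>{\<tau><..<t}. heat_semigroup (D2 * (t - s)) (\<lambda>y. ennpowr (u y s) q) x \<partial>lebesgue)"
      using assms by (simp add: is_solution_def)
    then show ?thesis by (rule eventually_mono) auto
  qed
  then have "AE (t, x, \<tau>) in lebesgue. ?P x \<tau> t"
    by (rule AE_lebesgue_differentiable_preimage[where f = "\<lambda>(x, \<tau>, t). (t, x, \<tau>)"
          and g = "\<lambda>(t, x, \<tau>). (x, \<tau>, t)", THEN eventually_mono])
       (auto simp: split_def intro!: linear_imp_differentiable_on bounded_linear.linear
         bounded_linear_intros)
  then have "AE t in lebesgue. AE z in lebesgue. ?P (fst z) (snd z) t"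
    by (auto dest!: AE_lebesgue_pair simp: split_def)
  then have duh: "AE t in lebesgue. AE x in lebesgue. AE \<tau> in lebesgue. ?P x \<tau> t"
    by (rule eventually_mono) (auto dest!: AE_lebesgue_pair)
  show "supersolution D1 p T u v"
    unfolding supersolution_def
    using fin duh
  proof eventually_elim
    case (elim t)
    show ?case
    proof
      assume t: "0 < t \<and> t < T"
      from elim show "AE x in lebesgue. u x t < \<infinity> \<and>
        (AE \<tau> in lebesgue. 0 < \<tau> \<and> \<tau> < t \<longrightarrow>
          heat_semigroup (D1 * (t - \<tau>)) (\<lambda>y. u y \<tau>) x \<le> u x t \<and>
          (\<integral>\<^sup>+s\<in>{\<tau><..<t}. heat_semigroup (D1 * (t - s)) (\<lambda>y. ennpowr (v y s) p) x \<partial>lebesgue) \<le> u x t)"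
        by eventually_elim (use t in auto)
    qed
  qed
  show "supersolution D2 q T v u"
    unfolding supersolution_def
    using fin duh
  proof eventually_elim
    case (elim t)
    show ?case
    proof
      assume t: "0 < t \<and> t < T"
      from elim show "AE x in lebesgue. v x t < \<infinity> \<and>
        (AE \<tau> in lebesgue. 0 < \<tau> \<and> \<tau> < t \<longrightarrow>
          heat_semigroup (D2 * (t - \<tau>)) (\<lambda>y. v y \<tau>) x \<le> v x t \<and>
          (\<integral>\<^sup>+s\<in>{\<tau><..<t}. heat_semigroup (D2 * (t - s)) (\<lambda>y. ennpowr (u y s) q) x \<partial>lebesgue) \<le> v x t)"
        by eventually_elim (use t in auto)
    qed
  qed
qed

lemma borel_measurable_heat_kernel [measurable]:
  "(\<lambda>y::'a::euclidean_space. heat_kernel (x - y) h) \<in> borel_measurable borel"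
  unfolding heat_kernel_def by measurable

text \<open>Needed to take constants out of the integral that defines the heat semigroup.\<close>

lemma measurable_heat_kernel_on_ball:
  fixes x z :: "'a::euclidean_space"
  shows "(\<lambda>y. ennreal (heat_kernel (x - y) h) * indicator (ball z r) y) \<in> borel_measurable lebesgue"
proof -
  have [measurable]: "ball z r \<in> sets borel" by simp
  have "(\<lambda>y. ennreal (heat_kernel (x - y) h) * indicator (ball z r) y) \<in> borel_measurable borel"
    by measurable
  then show ?thesis by (intro measurable_completion) simp
qed

text \<open>The engine of the proof. A lower bound \<open>g s\<close> for \<open>v\<close> on balls passes through the source
  \<open>v\<^sup>p\<close> and the semigroup, whose effect on the indicator of the ball is estimated from
  below by \<open>k t s\<close>. The integral starts exactly at \<open>a\<close>, even for \<open>a = 0\<close>, although the equation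
  is available only for almost all initial times \<open>\<tau>\<close>: such \<open>\<tau>\<close> exist arbitrarily close to \<open>a\<close>,
  and the integrals over \<open>{\<tau><..<t}\<close> exhaust the one over \<open>{a<..<t}\<close>. The function \<open>b\<close> cuts off
  the times \<open>s\<close> for which the kernel bound is not available.\<close>

lemma duhamel_lower_bound:
  fixes u v :: "'a::euclidean_space \<Rightarrow> real \<Rightarrow> ennreal"
  assumes sup: "supersolution D p T u v" and p: "p > 0" and a: "a \<ge> 0"
    and low: "lower_bound_on_balls z a T \<rho> g v" and g: "\<And>s. a < s \<Longrightarrow> s < T \<Longrightarrow> g s \<ge> 0"
    and bt: "\<And>t. t > 0 \<Longrightarrow> b t \<le> t" and k: "\<And>t s. k t s \<ge> 0"
    and kernel: "\<And>t x s. a < s \<Longrightarrow> s < b t \<Longrightarrow> t < T \<Longrightarrow> x \<in> ball z (R t) \<Longrightarrow>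
      ennreal (k t s) \<le> heat_semigroup (D * (t - s)) (indicator (ball z (\<rho> s))) x"
  shows "AE t in lebesgue. a < t \<and> t < T \<longrightarrow> (AE x in lebesgue. x \<in> ball z (R t) \<longrightarrow>
      (\<integral>\<^sup>+s\<in>{a<..<b t}. ennreal (k t s * g s powr p) \<partial>lebesgue) \<le> u x t)"
  using sup[unfolded supersolution_def]
proof eventually_elim
  case (elim t)
  show ?case
  proof
    assume t: "a < t \<and> t < T"
    with elim a have "AE x in lebesgue. u x t < \<infinity> \<and> (AE \<tau> in lebesgue. 0 < \<tau> \<and> \<tau> < t \<longrightarrow>
        heat_semigroup (D * (t - \<tau>)) (\<lambda>y. u y \<tau>) x \<le> u x t \<and>
        (\<integral>\<^sup>+s\<in>{\<tau><..<t}. heat_semigroup (D * (t - s)) (\<lambda>y. ennpowr (v y s) p) x \<partial>lebesgue) \<le> u x t)"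
      by simp
    then show "AE x in lebesgue. x \<in> ball z (R t) \<longrightarrow>
      (\<integral>\<^sup>+s\<in>{a<..<b t}. ennreal (k t s * g s powr p) \<partial>lebesgue) \<le> u x t"
    proof eventually_elim
      case (elim x)
      show ?case
      proof
        assume x: "x \<in> ball z (R t)"
        show "(\<integral>\<^sup>+s\<in>{a<..<b t}. ennreal (k t s * g s powr p) \<partial>lebesgue) \<le> u x t"
        proof (rule nn_integral_greaterThanLessThan_le)
          fix n
          define a' where "a' = a + 1 / real (Suc n)"
          \<comment> \<open>The equation holds from some initial time \<open>\<tau>\<close> between \<open>a\<close> and the left end of the exhausting interval.\<close>
          have "a < min a' t" using t by (simp add: a'_def)
          then have ne: "{a<..<min a' t} \<noteq> {}" by (meson greaterThanLessThan_empty_iff not_le)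
          obtain \<tau> where \<tau>: "\<tau> \<in> {a<..<min a' t}"
            and \<tau>u: "0 < \<tau> \<and> \<tau> < t \<longrightarrow>
              heat_semigroup (D * (t - \<tau>)) (\<lambda>y. u y \<tau>) x \<le> u x t \<and>
              (\<integral>\<^sup>+s\<in>{\<tau><..<t}. heat_semigroup (D * (t - s)) (\<lambda>y. ennpowr (v y s) p) x \<partial>lebesgue) \<le> u x t"
            using AE_lebesgue_obtain_in_open[OF conjunct2[OF elim] open_greaterThanLessThan ne] by blast
          have "(\<integral>\<^sup>+s\<in>{a'<..<b t}. ennreal (k t s * g s powr p) \<partial>lebesgue)
              \<le> (\<integral>\<^sup>+s\<in>{\<tau><..<t}. heat_semigroup (D * (t - s)) (\<lambda>y. ennpowr (v y s) p) x \<partial>lebesgue)"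
          proof (rule nn_integral_mono_AE)
            show "AE s in lebesgue. ennreal (k t s * g s powr p) * indicator {a'<..<b t} s
              \<le> heat_semigroup (D * (t - s)) (\<lambda>y. ennpowr (v y s) p) x * indicator {\<tau><..<t} s"
              using low[unfolded lower_bound_on_balls_def]
            proof eventually_elim
              case (elim s)
              show ?case
              proof (cases "a' < s \<and> s < b t")
                case True
                then have s: "a < s" "s < t" "\<tau> < s" "s < T" 
                  using \<tau> bt[of t] t a True by simp_all
                have vs: "AE y in lebesgue. y \<in> ball z (\<rho> s) \<longrightarrow> ennreal (g s) \<le> v y s"
                  using elim s by auto
                have "ennreal (k t s * g s powr p) = ennreal (k t s) * ennreal (g s powr p)"
                  by (rule ennreal_mult) (auto simp: k)
                also have "\<dots> \<le> heat_semigroup (D * (t - s)) (indicator (ball z (\<rho> s))) x * ennreal (g s powr p)"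
                  using True s x t by (intro mult_right_mono kernel) simp_all
                also have "\<dots> = (\<integral>\<^sup>+y. ennreal (heat_kernel (x - y) (D * (t - s))) * indicator (ball z (\<rho> s)) y
                    * ennreal (g s powr p) \<partial>lebesgue)"
                  unfolding heat_semigroup_def
                  by (rule nn_integral_multc[symmetric]) (rule measurable_heat_kernel_on_ball)
                also have "\<dots> \<le> heat_semigroup (D * (t - s)) (\<lambda>y. ennpowr (v y s) p) x"
                  unfolding heat_semigroup_def
                proof (rule nn_integral_mono_AE, use vs in eventually_elim)
                  case (elim y)
                  have "ennreal (g s powr p) \<le> ennpowr (v y s) p" if "y \<in> ball z (\<rho> s)"
                    using elim that ennpowr_mono[OF p, of "ennreal (g s)" "v y s"] g[of s] s
                    by (simp add: ennpowr_ennreal)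
                  then show ?case
                    by (simp add: mult_left_mono split: split_indicator)
                qed
                finally show ?thesis using True s by simp
              next
                case False
                then show ?thesis by simp
              qed
            qed
          qed
          also have "\<dots> \<le> u x t" using \<tau>u \<tau> a by simp
          finally show "(\<integral>\<^sup>+s\<in>{a + 1 / real (Suc n)<..<b t}. ennreal (k t s * g s powr p) \<partial>lebesgue) \<le> u x t"
            unfolding a'_def .
        qed
      qed
    qed
  qed
qed

section \<open>Lower bounds for the heat semigroup\<close>

lemma heat_kernel_ge:
  fixes x :: "'a::euclidean_space"
  assumes "0 < h" and "h \<le> H" and "norm x \<le> r"
  shows "(4 * pi * H) powr (- real DIM('a) / 2) * exp (- r\<^sup>2 / (4 * h)) \<le> heat_kernel x h"
  unfolding heat_kernel_def
proof (rule mult_mono)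
  show "(4 * pi * H) powr (- real DIM('a) / 2) \<le> (4 * pi * h) powr (- real DIM('a) / 2)"
    using assms by (intro powr_mono2') auto
  have "(norm x)\<^sup>2 \<le> r\<^sup>2" using assms by (intro power_mono) auto
  then show "exp (- r\<^sup>2 / (4 * h)) \<le> exp (- (norm x)\<^sup>2 / (4 * h))"
    using assms by (simp add: divide_right_mono)
qed auto

lemma heat_semigroup_indicator_ge:
  fixes x :: "'a::euclidean_space"
  assumes "\<And>y. y \<in> ball w \<rho> \<Longrightarrow> \<kappa> \<le> heat_kernel (x - y) h" and "ball w \<rho> \<subseteq> E"
    and "0 \<le> \<kappa>" and "0 \<le> \<rho>"
  shows "ennreal (\<kappa> * (unit_ball_vol DIM('a) * \<rho> ^ DIM('a))) \<le> heat_semigroup h (indicator E) x"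
proof -
  have "ennreal (\<kappa> * (unit_ball_vol DIM('a) * \<rho> ^ DIM('a)))
      = ennreal \<kappa> * emeasure lebesgue (ball w \<rho>)"
    using assms by (simp add: emeasure_ball ennreal_mult)
  also have "\<dots> = (\<integral>\<^sup>+y. ennreal \<kappa> * indicator (ball w \<rho>) y \<partial>lebesgue)"
    by (simp add: nn_integral_cmult_indicator)
  also have "\<dots> \<le> heat_semigroup h (indicator E) x"
    unfolding heat_semigroup_def
  proof (rule nn_integral_mono)
    fix y
    show "ennreal \<kappa> * indicator (ball w \<rho>) y \<le> ennreal (heat_kernel (x - y) h) * indicator E y"
      using assms(1)[of y] assms(2) by (auto split: split_indicator intro!: ennreal_leI)
  qed
  finally show ?thesis .
qed

lemma sqrt_power_eq_powr: "0 < s \<Longrightarrow> sqrt s ^ n = s powr (real n / 2)"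
  by (simp add: powr_half_sqrt[symmetric] powr_realpow[symmetric] powr_powr)

text \<open>A heat kernel at time \<open>D h\<close> is at least \<open>(4 pi D h) powr (- N / 2) * exp (- 1 / (4 D))\<close> at
  distance up to \<open>sqrt h\<close>. The remaining factor is the volume of a ball of radius \<open>sqrt h / 2\<close>,
  up to a power of \<open>h\<close> that cancels.\<close>

definition same_ball_const :: "real \<Rightarrow> real \<Rightarrow> real" where
  "same_ball_const N D = (4 * pi * D) powr (- N / 2) * exp (- 1 / (4 * D)) * unit_ball_vol N / 2 powr N"

lemma same_ball_const_pos: "N \<ge> 0 \<Longrightarrow> D > 0 \<Longrightarrow> same_ball_const N D > 0"
  by (simp add: same_ball_const_def)

text \<open>Even for \<open>x\<close> near the boundary of \<open>ball z r\<close>, a ball of radius \<open>sqrt h / 2\<close> fits into the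
  intersection of \<open>ball z r\<close> with the closed ball of radius \<open>sqrt h\<close> about \<open>x\<close>: move its centre
  from \<open>x\<close> by the fraction \<open>sqrt h / (2 r) \<le> 1/2\<close> of the way to \<open>z\<close>. Because the ball does not
  shrink, the estimate can be iterated on one and the same ball.\<close>

lemma heat_semigroup_same_ball_ge:
  fixes x :: "'a::euclidean_space"
  assumes D: "D > 0" and h: "0 < h" "h \<le> r\<^sup>2" and r: "r > 0" and x: "x \<in> ball z r"
  shows "ennreal (same_ball_const DIM('a) D) \<le> heat_semigroup (D * h) (indicator (ball z r)) x"
proof -
  define l where "l = sqrt h / (2 * r)"
  define w where "w = x + l *\<^sub>R (z - x)"
  have sh: "sqrt h \<le> r" using h r by (simp add: real_le_lsqrt)
  have l: "0 \<le> l" "l \<le> 1/2" "l * r = sqrt h / 2"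
    using sh r h by (auto simp: l_def field_simps)
  have xz: "norm (x - z) < r" using x by (simp add: dist_norm norm_minus_commute)
  have xw: "norm (x - w) \<le> sqrt h / 2"
  proof -
    have "norm (x - w) = l * norm (x - z)" using l by (simp add: w_def norm_minus_commute)
    also have "\<dots> \<le> l * r" using l xz by (intro mult_left_mono) auto
    finally show ?thesis using l by simp
  qed
  have zw: "norm (z - w) \<le> r - sqrt h / 2"
  proof -
    have "z - w = (1 - l) *\<^sub>R (z - x)" by (simp add: w_def algebra_simps)
    then have "norm (z - w) = (1 - l) * norm (x - z)" using l by (simp add: norm_minus_commute)
    also have "\<dots> \<le> (1 - l) * r" using l xz by (intro mult_left_mono) auto
    finally show ?thesis using l by (simp add: algebra_simps)
  qed
  let ?\<kappa> = "(4 * pi * (D * h)) powr (- real DIM('a) / 2) * exp (- (sqrt h)\<^sup>2 / (4 * (D * h)))"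
  have "ennreal (?\<kappa> * (unit_ball_vol DIM('a) * (sqrt h / 2) ^ DIM('a)))
      \<le> heat_semigroup (D * h) (indicator (ball z r)) x"
  proof (rule heat_semigroup_indicator_ge)
    show "ball w (sqrt h / 2) \<subseteq> ball z r"
    proof
      fix y assume "y \<in> ball w (sqrt h / 2)"
      then have "norm (w - y) < sqrt h / 2" by (simp add: dist_norm)
      moreover have "norm (z - y) \<le> norm (z - w) + norm (w - y)"
        using norm_triangle_ineq[of "z - w" "w - y"] by simp
      ultimately show "y \<in> ball z r" using zw by (simp add: dist_norm)
    qed
    fix y assume "y \<in> ball w (sqrt h / 2)"
    then have "norm (w - y) < sqrt h / 2" by (simp add: dist_norm)
    moreover have "norm (x - y) \<le> norm (x - w) + norm (w - y)"
      using norm_triangle_ineq[of "x - w" "w - y"] by simp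
    ultimately have "norm (x - y) \<le> sqrt h" using xw by simp
    then show "?\<kappa> \<le> heat_kernel (x - y) (D * h)"
      using D h by (intro heat_kernel_ge) auto
  qed (use h in auto)
  also have "?\<kappa> * (unit_ball_vol DIM('a) * (sqrt h / 2) ^ DIM('a)) = same_ball_const DIM('a) D"
  proof -
    have "h powr (- real DIM('a) / 2) * h powr (real DIM('a) / 2) = 1"
      using h by (simp add: powr_add[symmetric])
    moreover have "(4 * pi * (D * h)) powr (- real DIM('a) / 2)
        = (4 * pi * D) powr (- real DIM('a) / 2) * h powr (- real DIM('a) / 2)"
      using D h by (simp add: powr_mult[symmetric] mult.assoc)
    moreover have "(sqrt h / 2) ^ DIM('a) = h powr (real DIM('a) / 2) / 2 powr real DIM('a)"
      using h by (simp add: power_divide sqrt_power_eq_powr powr_realpow)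
    moreover have "exp (- (sqrt h)\<^sup>2 / (4 * (D * h))) = exp (- 1 / (4 * D))"
      using h D by simp
    ultimately show ?thesis
      unfolding same_ball_const_def by (simp add: mult_ac)
  qed
  finally show ?thesis .
qed

definition spread_const :: "real \<Rightarrow> real \<Rightarrow> real" where
  "spread_const N D = (4 * pi * D) powr (- N / 2) * exp (- 2 / D) * unit_ball_vol N"

lemma spread_const_pos: "N \<ge> 0 \<Longrightarrow> D > 0 \<Longrightarrow> spread_const N D > 0"
  by (simp add: spread_const_def)

text \<open>Since \<open>s \<le> t / 2\<close>, the elapsed time is comparable with \<open>t\<close>, and all distances between
  points of the two balls are at most \<open>2 * sqrt t\<close>; so the kernel is of order \<open>t powr (- N / 2)\<close>
  and the mass of the small ball is spread over the large one.\<close>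

lemma heat_semigroup_spread_ge:
  fixes x :: "'a::euclidean_space"
  assumes D: "D > 0" and s: "0 < s" "s \<le> t / 2" and x: "x \<in> ball z (sqrt t)"
  shows "ennreal (spread_const DIM('a) D * t powr (- real DIM('a) / 2) * s powr (real DIM('a) / 2))
    \<le> heat_semigroup (D * (t - s)) (indicator (ball z (sqrt s))) x"
proof -
  let ?\<kappa> = "(4 * pi * (D * t)) powr (- real DIM('a) / 2) * exp (- 2 / D)"
  have "ennreal (?\<kappa> * (unit_ball_vol DIM('a) * sqrt s ^ DIM('a)))
      \<le> heat_semigroup (D * (t - s)) (indicator (ball z (sqrt s))) x"
  proof (rule heat_semigroup_indicator_ge)
    fix y assume y: "y \<in> ball z (sqrt s)"
    have "sqrt s \<le> sqrt t" using s by simp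
    moreover have "norm (y - z) < sqrt s" using y by (simp add: dist_norm norm_minus_commute)
    ultimately have "norm (y - z) \<le> sqrt t" by linarith
    moreover have "norm (x - z) \<le> sqrt t" using x by (simp add: dist_norm norm_minus_commute)
    ultimately have "norm (x - y) \<le> 2 * sqrt t"
      using norm_triangle_ineq4[of "x - z" "y - z"] by simp
    then have "(4 * pi * (D * t)) powr (- real DIM('a) / 2)
        * exp (- (2 * sqrt t)\<^sup>2 / (4 * (D * (t - s)))) \<le> heat_kernel (x - y) (D * (t - s))"
      using D s by (intro heat_kernel_ge) auto
    moreover have "exp (- 2 / D) \<le> exp (- (2 * sqrt t)\<^sup>2 / (4 * (D * (t - s))))"
    proof -
      have "(2 * sqrt t)\<^sup>2 / (4 * (D * (t - s))) = t / (D * (t - s))"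
        using s by (simp add: power_mult_distrib)
      also have "\<dots> \<le> t / (D * (t / 2))"
        using s D by (intro divide_left_mono mult_left_mono mult_pos_pos) auto
      also have "\<dots> = 2 / D" using s by simp
      finally show ?thesis by simp
    qed
    ultimately show "?\<kappa> \<le> heat_kernel (x - y) (D * (t - s))"
      by (meson mult_left_mono order_trans powr_ge_zero)
  qed (use s in auto)
  also have "?\<kappa> * (unit_ball_vol DIM('a) * sqrt s ^ DIM('a))
      = spread_const DIM('a) D * t powr (- real DIM('a) / 2) * s powr (real DIM('a) / 2)"
  proof -
    have "(4 * pi * (D * t)) powr (- real DIM('a) / 2)
        = (4 * pi * D) powr (- real DIM('a) / 2) * t powr (- real DIM('a) / 2)"
      using D s by (simp add: powr_mult[symmetric] mult.assoc)
    then show ?thesis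
      using s unfolding spread_const_def by (simp add: sqrt_power_eq_powr mult_ac)
  qed
  finally show ?thesis .
qed

section \<open>The influence of the initial trace\<close>

lemma at_zero_within_positive_minus_negligible:
  fixes S :: "real set"
  assumes "negligible S"
  shows "at 0 within ({0<..} - S) \<noteq> bot"
proof -
  have "AE x in lebesgue. x \<notin> S" using assms by (simp add: AE_lebesgue_iff_negligible)
  then have "\<exists>y\<in>{0<..<e}. y \<notin> S" if "e > 0" for e :: real
    by (rule AE_lebesgue_obtain_in_open) (use that in auto)
  then have "0 islimpt ({0<..} - S)"
    unfolding islimpt_approachable by (force simp: dist_real_def)
  then show ?thesis by (simp add: trivial_limit_within)
qed

text \<open>A supersolution dominates, at positive times, the heat flow of its initial trace. Only
  balls are needed: a tent function between the indicators of \<open>ball z r\<close> and \<open>ball z (2 * r)\<close> is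
  a legitimate test function for the trace, and for \<open>\<tau> \<le> t / 2\<close> the kernel from time \<open>\<tau>\<close> to time
  \<open>t\<close> is bounded below on the support of the tent uniformly in \<open>\<tau>\<close>. Hence the limit
  \<open>\<tau> \<longlongrightarrow> 0\<close> can be taken. The quantifiers over \<open>z\<close> and \<open>r\<close> stay inside the
  almost-everywhere statement, which permits radii that depend on \<open>t\<close>.\<close>

lemma initial_trace_lower_bound:
  fixes u v :: "'a::euclidean_space \<Rightarrow> real \<Rightarrow> ennreal"
  assumes sup: "supersolution D p T u v" and D: "D > 0"
    and trace: "has_initial_trace u \<mu>" and radon: "radon_measure \<mu>"
  shows "AE t in lebesgue. 0 < t \<and> t < T \<longrightarrow> (AE x in lebesgue. \<forall>z r. 0 < r \<longrightarrow>
    ennreal ((4 * pi * (D * t)) powr (- real DIM('a) / 2) * exp (- (norm (x - z) + 2 * r)\<^sup>2 / (2 * (D * t))))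
      * emeasure \<mu> (ball z r) \<le> u x t)"
  using sup[unfolded supersolution_def]
proof eventually_elim
  case (elim t)
  show ?case
  proof
    assume t: "0 < t \<and> t < T"
    with elim have "AE x in lebesgue. AE \<tau> in lebesgue. 0 < \<tau> \<and> \<tau> < t \<longrightarrow>
        heat_semigroup (D * (t - \<tau>)) (\<lambda>y. u y \<tau>) x \<le> u x t"
      by auto
    then show "AE x in lebesgue. \<forall>z r. 0 < r \<longrightarrow>
      ennreal ((4 * pi * (D * t)) powr (- real DIM('a) / 2) * exp (- (norm (x - z) + 2 * r)\<^sup>2 / (2 * (D * t))))
        * emeasure \<mu> (ball z r) \<le> u x t"
    proof (eventually_elim, intro allI impI)
      fix x z :: 'a and r :: real
      assume good: "AE \<tau> in lebesgue. 0 < \<tau> \<and> \<tau> < t \<longrightarrow> heat_semigroup (D * (t - \<tau>)) (\<lambda>y. u y \<tau>) x \<le> u x t"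
        and r: "r > 0"
      define \<kappa> where "\<kappa> = (4 * pi * (D * t)) powr (- real DIM('a) / 2) * exp (- (norm (x - z) + 2 * r)\<^sup>2 / (2 * (D * t)))"
      have \<kappa>0: "\<kappa> \<ge> 0" by (simp add: \<kappa>_def)
      define \<phi> where "\<phi> y = max 0 (min 1 (2 - norm (y - z) / r))" for y
      have \<phi>01: "0 \<le> \<phi> y" "\<phi> y \<le> 1" for y by (auto simp: \<phi>_def)
      have \<phi>1: "\<phi> y = 1" if "y \<in> ball z r" for y
        using that r by (simp add: \<phi>_def dist_norm norm_minus_commute)
      have \<phi>0: "\<phi> y = 0" if "norm (y - z) \<ge> 2 * r" for y
        using that r by (simp add: \<phi>_def max_def field_simps)
      have \<phi>c: "continuous_on UNIV \<phi>"
        unfolding \<phi>_def using r by (intro continuous_intros) auto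
      have sub: "closure {y. \<phi> y \<noteq> 0} \<subseteq> cball z (2 * r)"
        using \<phi>0 by (intro closure_minimal) (force simp: dist_norm norm_minus_commute)+
      then have "compact (closure {y. \<phi> y \<noteq> 0})"
        by (metis closed_closure compact_Int_closed compact_cball inf.absorb_iff2)
      then have "\<phi> \<in> compactly_supported_continuous"
        using \<phi>c by (simp add: compactly_supported_continuous_def)
      then obtain Z where Z: "negligible Z"
        and int: "\<forall>\<^sub>F \<tau> in at 0 within ({0<..} - Z). integrable lebesgue (\<lambda>y. enn2real (u y \<tau>) * \<phi> y)"
        and lim: "((\<lambda>\<tau>. \<integral>y. enn2real (u y \<tau>) * \<phi> y \<partial>lebesgue) \<longlongrightarrow> (\<integral>y. \<phi> y \<partial>\<mu>)) (at 0 within ({0<..} - Z))"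
        using trace unfolding has_initial_trace_def by blast
      \<comment> \<open>the initial times that are excluded by the essential limit or by Duhamel's formula\<close>
      define S where "S = Z \<union> {\<tau>. \<not> (0 < \<tau> \<and> \<tau> < t \<longrightarrow> heat_semigroup (D * (t - \<tau>)) (\<lambda>y. u y \<tau>) x \<le> u x t)}"
      have S: "negligible S"
        using Z good unfolding S_def AE_lebesgue_iff_negligible by (rule negligible_Un)
      let ?F = "at 0 within ({0<..} - S)"
      have le: "?F \<le> at 0 within ({0<..} - Z)"
        by (rule at_le) (auto simp: S_def)
      have "((\<lambda>\<tau>. ennreal (\<kappa> * (\<integral>y. enn2real (u y \<tau>) * \<phi> y \<partial>lebesgue))) \<longlongrightarrow> ennreal (\<kappa> * (\<integral>y. \<phi> y \<partial>\<mu>))) ?F"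
        by (intro tendsto_ennrealI tendsto_mult tendsto_const tendsto_mono[OF le lim])
      moreover have "\<forall>\<^sub>F \<tau> in ?F. ennreal (\<kappa> * (\<integral>y. enn2real (u y \<tau>) * \<phi> y \<partial>lebesgue)) \<le> u x t"
      proof -
        have "\<forall>\<^sub>F \<tau> in ?F. \<tau> < t / 2"
          using t by (intro order_tendstoD(2)[OF tendsto_ident_at]) simp 
        moreover have "\<forall>\<^sub>F \<tau> in ?F. \<tau> \<in> {0<..} - S"
          by (simp add: eventually_at_filter)
        moreover have "\<forall>\<^sub>F \<tau> in ?F. integrable lebesgue (\<lambda>y. enn2real (u y \<tau>) * \<phi> y)"
          by (rule filter_leD[OF le int])
        ultimately show ?thesis
        proof eventually_elim
          case (elim \<tau>)
          then have \<tau>: "0 < \<tau>" "\<tau> < t / 2" by auto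
          have "ennreal (\<kappa> * (\<integral>y. enn2real (u y \<tau>) * \<phi> y \<partial>lebesgue))
              = ennreal (\<integral>y. \<kappa> * (enn2real (u y \<tau>) * \<phi> y) \<partial>lebesgue)"
            by simp
          also have "\<dots> = (\<integral>\<^sup>+y. ennreal (\<kappa> * (enn2real (u y \<tau>) * \<phi> y)) \<partial>lebesgue)"
            using elim \<kappa>0 \<phi>01 by (intro nn_integral_eq_integral[symmetric]) auto
          also have "\<dots> \<le> heat_semigroup (D * (t - \<tau>)) (\<lambda>y. u y \<tau>) x"
            unfolding heat_semigroup_def
          proof (rule nn_integral_mono)
            fix y
            have "\<kappa> * \<phi> y \<le> heat_kernel (x - y) (D * (t - \<tau>))"
            proof (cases "norm (y - z) < 2 * r")
              case True
              have "norm (x - y) \<le> norm (x - z) + 2 * r"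
                using True norm_triangle_ineq4[of "x - z" "y - z"] by simp
              then have *: "(4 * pi * (D * t)) powr (- real DIM('a) / 2)
                * exp (- (norm (x - z) + 2 * r)\<^sup>2 / (4 * (D * (t - \<tau>)))) \<le> heat_kernel (x - y) (D * (t - \<tau>))"
                using D \<tau> by (intro heat_kernel_ge) auto
              have "(norm (x - z) + 2 * r)\<^sup>2 / (4 * (D * (t - \<tau>))) \<le> (norm (x - z) + 2 * r)\<^sup>2 / (2 * (D * t))"
                using D \<tau> by (intro divide_left_mono mult_pos_pos) (auto simp: algebra_simps)
              then have "exp (- (norm (x - z) + 2 * r)\<^sup>2 / (2 * (D * t))) \<le> exp (- (norm (x - z) + 2 * r)\<^sup>2 / (4 * (D * (t - \<tau>))))"
                by simp
              then have "\<kappa> \<le> heat_kernel (x - y) (D * (t - \<tau>))"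
                using * unfolding \<kappa>_def by (meson mult_left_mono order_trans powr_ge_zero)
              then show ?thesis using \<phi>01[of y] \<kappa>0 by (meson mult_left_le order_trans)
            next
              case False
              then show ?thesis using \<phi>0[of y] by (simp add: heat_kernel_def)
            qed
            then have "ennreal (\<kappa> * \<phi> y) * ennreal (enn2real (u y \<tau>))
                \<le> ennreal (heat_kernel (x - y) (D * (t - \<tau>))) * u y \<tau>"
              by (intro mult_mono ennreal_leI) (auto simp: ennreal_enn2real_if)
            then show "ennreal (\<kappa> * (enn2real (u y \<tau>) * \<phi> y)) \<le> ennreal (heat_kernel (x - y) (D * (t - \<tau>))) * u y \<tau>"
              using \<kappa>0 \<phi>01[of y] by (simp add: ennreal_mult[symmetric] mult_ac)
          qed
          also have "\<dots> \<le> u x t" using elim \<tau> by (auto simp: S_def)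
          finally show ?case .
        qed
      qed
      ultimately have main: "ennreal (\<kappa> * (\<integral>y. \<phi> y \<partial>\<mu>)) \<le> u x t"
        by (rule tendsto_upperbound) (rule at_zero_within_positive_minus_negligible[OF S])
      have sets: "sets \<mu> = sets borel" using radon by (simp add: radon_measure_def)
      have \<phi>m: "\<phi> \<in> borel_measurable \<mu>"
        using borel_measurable_continuous_onI[OF \<phi>c] by (simp add: measurable_cong_sets[OF sets refl])
      have \<phi>int: "integrable \<mu> \<phi>"
      proof (rule Bochner_Integration.integrable_bound[OF _ \<phi>m])
        show "integrable \<mu> (indicat_real (cball z (2 * r)))"
          using radon by (auto simp: radon_measure_def intro!: integrable_real_indicator)
        show "AE y in \<mu>. norm (\<phi> y) \<le> norm (indicat_real (cball z (2 * r)) y)"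
          using \<phi>0 \<phi>01 by (intro AE_I2) (auto simp: dist_norm norm_minus_commute split: split_indicator)
      qed
      have "emeasure \<mu> (ball z r) = (\<integral>\<^sup>+y. indicator (ball z r) y \<partial>\<mu>)"
        by (simp add: sets)
      also have "\<dots> \<le> (\<integral>\<^sup>+y. ennreal (\<phi> y) \<partial>\<mu>)"
        using \<phi>1 by (intro nn_integral_mono) (simp split: split_indicator)
      also have "\<dots> = ennreal (\<integral>y. \<phi> y \<partial>\<mu>)"
        using \<phi>int \<phi>01 by (intro nn_integral_eq_integral) auto
      finally have "ennreal \<kappa> * emeasure \<mu> (ball z r) \<le> ennreal \<kappa> * ennreal (\<integral>y. \<phi> y \<partial>\<mu>)"
        by (rule mult_left_mono) simp
      also have "\<dots> = ennreal (\<kappa> * (\<integral>y. \<phi> y \<partial>\<mu>))"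
        using \<kappa>0 \<phi>01 by (simp add: ennreal_mult)
      finally show "ennreal ((4 * pi * (D * t)) powr (- real DIM('a) / 2) * exp (- (norm (x - z) + 2 * r)\<^sup>2 / (2 * (D * t))))
        * emeasure \<mu> (ball z r) \<le> u x t"
        using main unfolding \<kappa>_def by (rule order_trans)
    qed
  qed
qed

section \<open>Propagation of lower bounds\<close>

lemma lower_bound_on_ballsI:
  assumes "AE t in lebesgue. a < t \<and> t < T \<longrightarrow> (AE x in lebesgue. x \<in> ball z (\<rho> t) \<longrightarrow> I t \<le> u x t)"
    and "a \<le> a'" and "\<And>t. a' < t \<Longrightarrow> t < T \<Longrightarrow> ennreal (g t) \<le> I t"
  shows "lower_bound_on_balls z a' T \<rho> g u"
  unfolding lower_bound_on_balls_def
  using assms(1)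
proof eventually_elim
  case (elim t)
  show ?case
  proof
    assume t: "a' < t \<and> t < T"
    then have "AE x in lebesgue. x \<in> ball z (\<rho> t) \<longrightarrow> I t \<le> u x t" using elim assms(2) by auto
    then show "AE x in lebesgue. x \<in> ball z (\<rho> t) \<longrightarrow> ennreal (g t) \<le> u x t"
      by (rule eventually_mono) (use assms(3)[of t] t in \<open>auto intro: order_trans\<close>)
  qed
qed

lemma fixed_ball_step:
  fixes u v :: "'a::euclidean_space \<Rightarrow> real \<Rightarrow> ennreal"
  assumes sup: "supersolution D p T u v" and D: "D > 0" and p: "p > 0" and a: "a \<ge> 0"
    and r: "r > 0" "T - a \<le> r\<^sup>2" and m: "m \<ge> 0" and \<theta>: "\<theta> \<ge> 0"
    and low: "lower_bound_on_balls z a T (\<lambda>_. r) (\<lambda>_. m) v"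
  shows "lower_bound_on_balls z (a + \<theta>) T (\<lambda>_. r) (\<lambda>_. same_ball_const DIM('a) D * m powr p * \<theta>) u"
proof (rule lower_bound_on_ballsI)
  let ?c = "same_ball_const DIM('a) D"
  have c: "?c > 0" using D by (simp add: same_ball_const_pos)
  show "AE t in lebesgue. a < t \<and> t < T \<longrightarrow> (AE x in lebesgue. x \<in> ball z r \<longrightarrow>
      (\<integral>\<^sup>+s\<in>{a<..<t}. ennreal (?c * m powr p) \<partial>lebesgue) \<le> u x t)"
    using c a m r by (intro duhamel_lower_bound[OF sup p a low] heat_semigroup_same_ball_ge D) auto
  fix t assume t: "a + \<theta> < t" "t < T"
  have "(\<integral>\<^sup>+s\<in>{a<..<t}. ennreal (?c * m powr p) \<partial>lebesgue) = ennreal (?c * m powr p) * ennreal (t - a)"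
    using t \<theta> by (simp add: nn_integral_cmult_indicator)
  also have "\<dots> = ennreal (?c * m powr p * (t - a))"
    using c t \<theta> by (simp add: ennreal_mult)
  finally show "ennreal (?c * m powr p * \<theta>) \<le> (\<integral>\<^sup>+s\<in>{a<..<t}. ennreal (?c * m powr p) \<partial>lebesgue)"
    using c t by (auto intro!: ennreal_leI mult_left_mono)
qed (use \<theta> in auto)

text \<open>Restricting Duhamel's formula to \<open>s < t / 2\<close> leaves out only a bounded amount of
  logarithmic time and makes the bound valid on all of the ball of radius \<open>sqrt t\<close>.\<close>

lemma spread_lower_bound:
  fixes u v :: "'a::euclidean_space \<Rightarrow> real \<Rightarrow> ennreal"
  assumes sup: "supersolution D p T u v" and D: "D > 0" and p: "p > 0" and a: "a \<ge> 0"
    and low: "lower_bound_on_balls z a T sqrt g v" and g: "\<And>s. a < s \<Longrightarrow> s < T \<Longrightarrow> g s \<ge> 0"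
  shows "AE t in lebesgue. a < t \<and> t < T \<longrightarrow> (AE x in lebesgue. x \<in> ball z (sqrt t) \<longrightarrow>
      (\<integral>\<^sup>+s\<in>{a<..<t / 2}. ennreal (spread_const DIM('a) D * t powr (- real DIM('a) / 2)
        * s powr (real DIM('a) / 2) * g s powr p) \<partial>lebesgue) \<le> u x t)"
  using a by (intro duhamel_lower_bound[OF sup p a low g] heat_semigroup_spread_ge D)
    (auto simp: spread_const_pos D less_imp_le)

section \<open>Blow-up and the resulting bounds\<close>

lemma lower_bound_on_balls_mono:
  assumes "lower_bound_on_balls z a T \<rho> g w" and "a \<le> a'"
    and "\<And>t. a' < t \<Longrightarrow> t < T \<Longrightarrow> \<rho>' t \<le> \<rho> t \<and> g' t \<le> g t"
  shows "lower_bound_on_balls z a' T \<rho>' g' w"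
  unfolding lower_bound_on_balls_def
  using assms(1)[unfolded lower_bound_on_balls_def]
proof eventually_elim
  case (elim t)
  show ?case
  proof
    assume t: "a' < t \<and> t < T"
    then have "AE x in lebesgue. x \<in> ball z (\<rho> t) \<longrightarrow> ennreal (g t) \<le> w x t"
      using elim assms(2) by auto
    then show "AE x in lebesgue. x \<in> ball z (\<rho>' t) \<longrightarrow> ennreal (g' t) \<le> w x t"
    proof (rule eventually_mono)
      fix x assume "x \<in> ball z (\<rho> t) \<longrightarrow> ennreal (g t) \<le> w x t"
      then show "x \<in> ball z (\<rho>' t) \<longrightarrow> ennreal (g' t) \<le> w x t"
        using assms(3)[of t] t by (auto intro: order_trans[OF ennreal_leI])
    qed
  qed
qed

text \<open>The contradiction behind all bounds: a solution is finite almost everywhere.\<close>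

lemma unbounded_lower_bounds_contradiction:
  fixes u v :: "'a::euclidean_space \<Rightarrow> real \<Rightarrow> ennreal"
  assumes sup: "supersolution D q T v u" and a: "0 \<le> a" "a < T" and r: "r > 0"
    and low: "\<And>k. lower_bound_on_balls z a T (\<lambda>_. r) (\<lambda>_. m * B ^ k) v" and m: "m > 0" and B: "B > 1"
  shows False
proof -
  have "AE t in lebesgue. \<forall>k. a < t \<and> t < T \<longrightarrow> (AE x in lebesgue. x \<in> ball z r \<longrightarrow> ennreal (m * B ^ k) \<le> v x t)"
    using low unfolding lower_bound_on_balls_def AE_all_countable by blast
  with sup have "AE t in lebesgue. a < t \<and> t < T \<longrightarrow> (AE x in lebesgue. v x t < \<infinity>) \<and>
      (\<forall>k. AE x in lebesgue. x \<in> ball z r \<longrightarrow> ennreal (m * B ^ k) \<le> v x t)"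
    unfolding supersolution_def
  proof eventually_elim
    case (elim t)
    show ?case
    proof
      assume "a < t \<and> t < T"
      moreover from this elim(1) a have "AE x in lebesgue. v x t < \<infinity>" by (auto elim: eventually_mono)
      ultimately show "(AE x in lebesgue. v x t < \<infinity>) \<and>
        (\<forall>k. AE x in lebesgue. x \<in> ball z r \<longrightarrow> ennreal (m * B ^ k) \<le> v x t)"
        using elim(2) by simp
    qed
  qed
  then have "\<exists>t\<in>{a<..<T}. a < t \<and> t < T \<longrightarrow> (AE x in lebesgue. v x t < \<infinity>) \<and>
      (\<forall>k. AE x in lebesgue. x \<in> ball z r \<longrightarrow> ennreal (m * B ^ k) \<le> v x t)"
    by (rule AE_lebesgue_obtain_in_open) (use a in auto)
  then obtain t where fin: "AE x in lebesgue. v x t < \<infinity>"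
    and lowt: "\<forall>k. AE x in lebesgue. x \<in> ball z r \<longrightarrow> ennreal (m * B ^ k) \<le> v x t"
    by auto
  have "AE x in lebesgue. v x t < \<infinity> \<and> (\<forall>k. x \<in> ball z r \<longrightarrow> ennreal (m * B ^ k) \<le> v x t)"
    using fin lowt[folded AE_all_countable] by eventually_elim simp
  then have "\<exists>x\<in>ball z r. v x t < \<infinity> \<and> (\<forall>k. x \<in> ball z r \<longrightarrow> ennreal (m * B ^ k) \<le> v x t)"
    by (rule AE_lebesgue_obtain_in_open) (use r in auto)
  then obtain x where x: "v x t < \<infinity>" "\<forall>k. ennreal (m * B ^ k) \<le> v x t"
    by auto
  then obtain V where V: "V \<ge> 0" "v x t = ennreal V"
    by (cases "v x t") auto
  obtain k where "V / m < B ^ k" using real_arch_pow[OF B] by blast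
  then have "V < m * B ^ k" using m by (simp add: field_simps)
  moreover have "m * B ^ k \<le> V" using x(2) V by (metis ennreal_le_iff)
  ultimately show False by simp
qed

text \<open>With \<open>L = T - a\<close>, let step \<open>k\<close> consist of two waiting times \<open>L / 8 * (1/2)^k\<close>, one for
  each equation; all steps are completed by time \<open>a + L / 2\<close>. The induction claims \<open>v \<ge> m B^k\<close>
  with \<open>B = 2 powr b\<close>. This \<open>B\<close> satisfies \<open>B powr (p q - 1) = 2 powr (q + 1)\<close>, so that the gain
  from the exponent \<open>p q\<close> compensates the decay of the waiting times at every step; what remains
  is the condition \<open>B \<le> C1 m powr (p q - 1) (L / 8) powr (q + 1)\<close> which holds if \<open>m\<close> exceeds
  \<open>C * L powr (- b)\<close>.\<close>

lemma fixed_ball_bound: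
  fixes D1 D2 p q :: real
  assumes D: "D1 > 0" "D2 > 0" and p: "p > 0" and q: "q > 0" and pq: "p * q > 1"
  shows "\<exists>C>0. \<forall>T (u :: 'a::euclidean_space \<Rightarrow> real \<Rightarrow> ennreal) v z a r m.
    supersolution D1 p T u v \<longrightarrow> supersolution D2 q T v u \<longrightarrow> 0 \<le> a \<longrightarrow> a < T \<longrightarrow> 0 < r \<longrightarrow> T - a \<le> r\<^sup>2 \<longrightarrow>
    0 < m \<longrightarrow> lower_bound_on_balls z a T (\<lambda>_. r) (\<lambda>_. m) v \<longrightarrow> m \<le> C * (T - a) powr (- ((q + 1) / (p * q - 1)))"
proof -
  define b where "b = (q + 1) / (p * q - 1)"
  have b: "b > 0" "b * (p * q - 1) = q + 1" using pq q by (auto simp: b_def)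
  define B :: real where "B = 2 powr b"
  have B: "B > 1" using b by (simp add: B_def)
  define c1 where "c1 = same_ball_const DIM('a) D1"
  define c2 where "c2 = same_ball_const DIM('a) D2"
  have c: "c1 > 0" "c2 > 0" using D by (auto simp: c1_def c2_def same_ball_const_pos)
  define C1 where "C1 = c2 * c1 powr q"
  have C1: "C1 > 0" using c by (simp add: C1_def)
  define C where "C = (B / C1) powr (1 / (p * q - 1)) * 8 powr b"
  have C: "C > 0" using B C1 by (simp add: C_def)
  have "m \<le> C * (T - a) powr (- b)"
    if sup: "supersolution D1 p T u v" "supersolution D2 q T v u" and a: "0 \<le> a" "a < T"
      and r: "0 < r" "T - a \<le> r\<^sup>2" and m: "0 < m" and low: "lower_bound_on_balls z a T (\<lambda>_. r) (\<lambda>_. m) v"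
    for T and u v :: "'a \<Rightarrow> real \<Rightarrow> ennreal" and z a r m
  proof (rule ccontr)
    assume "\<not> m \<le> C * (T - a) powr (- b)"
    then have mC: "C * (T - a) powr (- b) < m" by simp
    define L where "L = T - a"
    have L: "L > 0" using a by (simp add: L_def)
    have start: "B \<le> C1 * m powr (p * q - 1) * (L / 8) powr (q + 1)"
    proof -
      have "(C * L powr (- b)) powr (p * q - 1) \<le> m powr (p * q - 1)"
        using mC C pq by (intro powr_mono2) (auto simp: L_def)
      moreover have "(C * L powr (- b)) powr (p * q - 1) = (B / C1) * (8 powr (q + 1) * L powr (- (q + 1)))"
      proof -
        have "L powr (- b * (p * q - 1)) = L powr (- (q + 1))" using b(2) by (metis mult_minus_left)
        moreover have "8 powr (b * (p * q - 1)) = 8 powr (q + 1)" by (simp only: b(2))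
        ultimately show ?thesis
          using B C1 pq by (simp add: C_def powr_mult powr_powr)
      qed
      ultimately have "(B / C1) * (8 powr (q + 1) * L powr (- (q + 1))) \<le> m powr (p * q - 1)" by simp
      then have "C1 * ((B / C1) * (8 powr (q + 1) * L powr (- (q + 1)))) * (L / 8) powr (q + 1)
          \<le> C1 * m powr (p * q - 1) * (L / 8) powr (q + 1)"
        using C1 by (intro mult_right_mono mult_left_mono) auto
      moreover have "(8 powr (q + 1) * L powr (- (q + 1))) * (L / 8) powr (q + 1) = 1"
        using L by (simp add: powr_divide powr_minus[of L "q + 1"] del: minus_add_distrib)
      ultimately show ?thesis using C1 by (simp add: mult.assoc)
    qed
    define t where "t k = a + (L / 2) * (1 - (1/2) ^ k)" for k :: nat
    have t0: "0 \<le> t k" "t k \<le> a + L / 2" "a \<le> t k" for k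
      using a L by (auto simp: t_def power_le_one)
    have step: "lower_bound_on_balls z (t k) T (\<lambda>_. r) (\<lambda>_. m * B ^ k) v" for k
    proof (induction k)
      case 0
      then show ?case using low by (simp add: t_def)
    next
      case (Suc k)
      define \<theta> where "\<theta> = (L / 8) * (1/2) ^ k"
      have \<theta>: "\<theta> > 0" using L by (simp add: \<theta>_def)
      define M where "M = m * B ^ k"
      have M: "M > 0" using m B by (simp add: M_def)
      have rk: "T - t k \<le> r\<^sup>2" "T - (t k + \<theta>) \<le> r\<^sup>2" using r t0(3)[of k] \<theta> by auto
      have "lower_bound_on_balls z (t k + \<theta>) T (\<lambda>_. r) (\<lambda>_. c1 * M powr p * \<theta>) u"
        unfolding c1_def
        using Suc.IH M \<theta> rk t0 r p D by (intro fixed_ball_step[OF sup(1)]) (auto simp: M_def)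
      then have "lower_bound_on_balls z (t k + \<theta> + \<theta>) T (\<lambda>_. r) (\<lambda>_. c2 * (c1 * M powr p * \<theta>) powr q * \<theta>) v"
        unfolding c2_def
        using M \<theta> rk t0 r q D c by (intro fixed_ball_step[OF sup(2)]) (auto simp: add_nonneg_nonneg less_imp_le)
      moreover have "t k + \<theta> + \<theta> = t (Suc k)"
        by (simp add: t_def \<theta>_def algebra_simps)
      moreover have "m * B ^ Suc k \<le> c2 * (c1 * M powr p * \<theta>) powr q * \<theta>"
      proof -
        have "c2 * (c1 * M powr p * \<theta>) powr q * \<theta> = C1 * M powr (p * q) * \<theta> powr (q + 1)"
          using \<theta> M c by (simp add: C1_def powr_mult powr_powr powr_add)
        also have "M powr (p * q) = M * (m powr (p * q - 1) * (B ^ k) powr (p * q - 1))"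
        proof -
          have "M powr (p * q) = M powr 1 * M powr (p * q - 1)" by (subst powr_add[symmetric]) simp
          then show ?thesis using M m B by (simp add: M_def powr_mult)
        qed
        also have "\<theta> powr (q + 1) = (L / 8) powr (q + 1) * ((1/2) ^ k) powr (q + 1)"
          unfolding \<theta>_def by (rule powr_mult)
        also have "C1 * (M * (m powr (p * q - 1) * (B ^ k) powr (p * q - 1))) * ((L / 8) powr (q + 1) * ((1/2) ^ k) powr (q + 1))
          = M * (C1 * m powr (p * q - 1) * (L / 8) powr (q + 1)) * ((B ^ k) powr (p * q - 1) * ((1/2) ^ k) powr (q + 1))"
          by (simp add: mult_ac)
        also have "(B ^ k) powr (p * q - 1) * ((1/2) ^ k) powr (q + 1) = 1"
        proof -
          have "B ^ k = 2 powr (b * real k)" by (simp add: B_def powr_realpow[symmetric] powr_powr)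
          then have "(B ^ k) powr (p * q - 1) = 2 powr (real k * (b * (p * q - 1)))"
            by (simp add: powr_powr mult_ac)
          moreover have "((1/2::real) ^ k) = 2 powr (- real k)"
            by (simp add: powr_minus powr_realpow power_divide inverse_eq_divide)
          ultimately show ?thesis by (simp add: b(2) powr_powr powr_add[symmetric])
        qed
        finally have eq: "c2 * (c1 * M powr p * \<theta>) powr q * \<theta> = M * (C1 * m powr (p * q - 1) * (L / 8) powr (q + 1))"
          by simp
        have "m * B ^ Suc k = M * B" by (simp add: M_def)
        also have "\<dots> \<le> M * (C1 * m powr (p * q - 1) * (L / 8) powr (q + 1))"
          using start M by (intro mult_left_mono) auto
        finally show ?thesis using eq by simp
      qed
      ultimately show ?case by (auto elim: lower_bound_on_balls_mono)
    qed
    have "lower_bound_on_balls z (a + L / 2) T (\<lambda>_. r) (\<lambda>_. m * B ^ k) v" for k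
      by (rule lower_bound_on_balls_mono[OF step[of k] t0(2)]) simp
    moreover have "0 \<le> a + L / 2" "a + L / 2 < T" using a by (simp_all add: L_def field_simps)
    ultimately show False
      using unbounded_lower_bounds_contradiction[OF sup(2) _ _ r(1) _ m B] by blast
  qed
  then show ?thesis using C unfolding b_def[symmetric] by blast
qed

text \<open>On \<open>{T / 2<..<T}\<close> a profile of mass \<open>m\<close> is bounded below by \<open>m T powr (- N / 2)\<close> on the
  fixed ball of radius \<open>sqrt (T / 2)\<close>, whose square is the time that is left.\<close>

lemma mass_bound:
  fixes D1 D2 p q :: real
  assumes D: "D1 > 0" "D2 > 0" and p: "p > 0" and q: "q > 0" and pq: "p * q > 1"
  shows "\<exists>C>0. \<forall>T (u :: 'a::euclidean_space \<Rightarrow> real \<Rightarrow> ennreal) v z a m.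
    supersolution D1 p T u v \<longrightarrow> supersolution D2 q T v u \<longrightarrow> 0 < T \<longrightarrow> a \<le> T / 2 \<longrightarrow> 0 < m \<longrightarrow>
    lower_bound_on_balls z a T sqrt (\<lambda>t. m * t powr (- real DIM('a) / 2)) v \<longrightarrow>
    m \<le> C * T powr (real DIM('a) / 2 - (q + 1) / (p * q - 1))"
proof -
  let ?b = "(q + 1) / (p * q - 1)" and ?N = "real DIM('a)"
  obtain C where C: "C > 0" and bound: "\<And>T (u :: 'a \<Rightarrow> real \<Rightarrow> ennreal) v z a r m.
    supersolution D1 p T u v \<Longrightarrow> supersolution D2 q T v u \<Longrightarrow> 0 \<le> a \<Longrightarrow> a < T \<Longrightarrow> 0 < r \<Longrightarrow> T - a \<le> r\<^sup>2 \<Longrightarrow>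
    0 < m \<Longrightarrow> lower_bound_on_balls z a T (\<lambda>_. r) (\<lambda>_. m) v \<Longrightarrow> m \<le> C * (T - a) powr (- ?b)"
    using fixed_ball_bound[OF assms, where 'a = 'a] by blast
  have "m \<le> (C * 2 powr ?b) * T powr (?N / 2 - ?b)"
    if sup: "supersolution D1 p T u v" "supersolution D2 q T v u" and T: "0 < T" "a \<le> T / 2" and m: "0 < m"
      and low: "lower_bound_on_balls z a T sqrt (\<lambda>t. m * t powr (- ?N / 2)) v"
    for T and u v :: "'a \<Rightarrow> real \<Rightarrow> ennreal" and z a m
  proof -
    have "lower_bound_on_balls z (T / 2) T (\<lambda>_. sqrt (T / 2)) (\<lambda>_. m * T powr (- ?N / 2)) v"
      using low T(2)
    proof (rule lower_bound_on_balls_mono)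
      fix t assume t: "T / 2 < t" "t < T"
      then have "T powr (- ?N / 2) \<le> t powr (- ?N / 2)" using T by (intro powr_mono2') auto
      then show "sqrt (T / 2) \<le> sqrt t \<and> m * T powr (- ?N / 2) \<le> m * t powr (- ?N / 2)"
        using t m by simp
    qed
    then have "m * T powr (- ?N / 2) \<le> C * (T - T / 2) powr (- ?b)"
      using T m by (intro bound[OF sup]) auto
    also have "(T - T / 2) powr (- ?b) = 2 powr ?b * T powr (- ?b)"
      using T by (simp add: powr_divide powr_minus_divide)
    finally have "m * T powr (- ?N / 2) * T powr (?N / 2) \<le> C * (2 powr ?b * T powr (- ?b)) * T powr (?N / 2)"
      by (rule mult_right_mono) simp
    moreover have "T powr (- ?N / 2) * T powr (?N / 2) = 1"
      using T by (simp add: powr_add[symmetric])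
    moreover have "T powr (- ?b) * T powr (?N / 2) = T powr (?N / 2 - ?b)"
      by (simp add: powr_add[symmetric])
    ultimately show ?thesis by (simp add: mult.assoc)
  qed
  then show ?thesis using C by (intro exI[of _ "C * 2 powr ?b"]) auto
qed

lemma nn_integral_inverse:
  fixes a b c :: real
  assumes "0 < a" and "a \<le> b" and "c \<ge> 0"
  shows "(\<integral>\<^sup>+s\<in>{a<..<b}. ennreal (c / s) \<partial>lebesgue) = ennreal (c * ln (b / a))"
proof -
  have "(\<integral>\<^sup>+s\<in>{a<..<b}. ennreal (c / s) \<partial>lebesgue) = (\<integral>\<^sup>+s\<in>{a<..<b}. ennreal (c / s) \<partial>lborel)"
    by (rule nn_integral_completion)
  also have "\<dots> = (\<integral>\<^sup>+s. ennreal (c / s) * indicator {a..b} s \<partial>lborel)"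
  proof (rule nn_integral_cong_AE)
    have "AE s in lborel. s \<noteq> a" "AE s in lborel. s \<noteq> b" by (auto intro: AE_lborel_singleton)
    then show "AE s in lborel. ennreal (c / s) * indicator {a<..<b} s = ennreal (c / s) * indicator {a..b} s"
      by eventually_elim (auto split: split_indicator)
  qed
  also have "\<dots> = ennreal (c * ln b - c * ln a)"
  proof (rule nn_integral_FTC_Icc)
    show "(\<lambda>s. c / s) \<in> borel_measurable borel" by measurable
    show "((\<lambda>s. c * ln s) has_real_derivative c / s) (at s)" if "s \<in> {a..b}" for s
      using that assms by (auto intro!: derivative_eq_intros)
  qed (use assms in auto)
  also have "c * ln b - c * ln a = c * ln (b / a)"
    using assms by (simp add: ln_div algebra_simps)
  finally show ?thesis .
qed

text \<open>When the source has the critical decay, that is, integrates to a multiple of \<open>1 / s\<close> over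
  balls of radius \<open>sqrt s\<close>, the mass grows linearly in logarithmic time.\<close>

lemma log_step:
  fixes u v :: "'a::euclidean_space \<Rightarrow> real \<Rightarrow> ennreal"
  assumes sup: "supersolution D p T u v" and D: "D > 0" and p: "p > 0" and a: "a > 0"
    and low: "lower_bound_on_balls z a T sqrt (\<lambda>s. m * s powr e) v"
    and e: "real DIM('a) / 2 + e * p = - 1" and m: "m \<ge> 0" and l: "l \<ge> 0"
  shows "lower_bound_on_balls z (2 * a * exp l) T sqrt
    (\<lambda>t. (spread_const DIM('a) D * m powr p * l) * t powr (- real DIM('a) / 2)) u"
proof (rule lower_bound_on_ballsI)
  let ?K = "spread_const DIM('a) D" and ?N = "real DIM('a)"
  have K: "?K > 0" using D by (simp add: spread_const_pos)
  show "AE t in lebesgue. a < t \<and> t < T \<longrightarrow> (AE x in lebesgue. x \<in> ball z (sqrt t) \<longrightarrow>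
      (\<integral>\<^sup>+s\<in>{a<..<t / 2}. ennreal (?K * t powr (- ?N / 2) * s powr (?N / 2) * (m * s powr e) powr p) \<partial>lebesgue) \<le> u x t)"
    using a m by (intro spread_lower_bound[OF sup D p _ low]) auto
  have "a * 1 \<le> a * exp l" using a l by (intro mult_left_mono) auto
  then show "a \<le> 2 * a * exp l" using a by linarith
  fix t assume t: "2 * a * exp l < t" "t < T"
  have lt: "exp l \<le> (t / 2) / a" using t a by (simp add: field_simps)
  have "exp l \<ge> 1" using l by simp
  then have at: "1 \<le> (t / 2) / a" using lt by linarith
  then have at': "a \<le> t / 2" using a by (simp add: field_simps)
  have "l \<le> ln ((t / 2) / a)" using lt by (subst ln_ge_iff) (auto intro: less_le_trans[OF exp_gt_zero])
  then have "(?K * t powr (- ?N / 2) * m powr p) * l \<le> (?K * t powr (- ?N / 2) * m powr p) * ln ((t / 2) / a)"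
    using K by (intro mult_left_mono) auto
  then have "ennreal ((?K * m powr p * l) * t powr (- ?N / 2)) \<le> ennreal ((?K * t powr (- ?N / 2) * m powr p) * ln ((t / 2) / a))"
    by (intro ennreal_leI) (simp only: mult_ac)
  also have "\<dots> = (\<integral>\<^sup>+s\<in>{a<..<t / 2}. ennreal ((?K * t powr (- ?N / 2) * m powr p) / s) \<partial>lebesgue)"
    using a at' K by (intro nn_integral_inverse[symmetric]) auto
  also have "\<dots> = (\<integral>\<^sup>+s\<in>{a<..<t / 2}. ennreal (?K * t powr (- ?N / 2) * s powr (?N / 2) * (m * s powr e) powr p) \<partial>lebesgue)"
  proof (intro nn_integral_cong)
    fix s
    show "ennreal ((?K * t powr (- ?N / 2) * m powr p) / s) * indicator {a<..<t / 2} s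
      = ennreal (?K * t powr (- ?N / 2) * s powr (?N / 2) * (m * s powr e) powr p) * indicator {a<..<t / 2} s"
    proof (cases "a < s")
      case True
      then have "s powr (?N / 2) * (m * s powr e) powr p = m powr p * s powr (?N / 2 + e * p)"
        using m a by (simp add: powr_mult powr_powr powr_add mult_ac)
      also have "\<dots> = m powr p / s"
        unfolding e using True a by (simp add: powr_minus_divide)
      finally show ?thesis by (simp add: mult.assoc)
    qed simp
  qed
  finally show "ennreal ((?K * m powr p * l) * t powr (- ?N / 2)) \<le>
    (\<integral>\<^sup>+s\<in>{a<..<t / 2}. ennreal (?K * t powr (- ?N / 2) * s powr (?N / 2) * (m * s powr e) powr p) \<partial>lebesgue)" .
qed

text \<open>The interval \<open>{t / 4<..<t / 2}\<close> has length \<open>t / 4\<close>, and \<open>4 powr (- \<bar>\<alpha>\<bar>)\<close> bounds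
  \<open>(s / t) powr \<alpha>\<close> from below on it, whatever the sign of \<open>\<alpha>\<close>.\<close>

definition power_step_const :: "real \<Rightarrow> real \<Rightarrow> real \<Rightarrow> real" where
  "power_step_const N D \<alpha> = spread_const N D * 4 powr (- \<bar>\<alpha>\<bar>) / 4"

lemma power_step_const_pos: "N \<ge> 0 \<Longrightarrow> D > 0 \<Longrightarrow> power_step_const N D \<alpha> > 0"
  by (simp add: power_step_const_def spread_const_pos)

text \<open>For a general decay rate \<open>e\<close> it suffices to use times \<open>s\<close> comparable with \<open>t\<close>; scaling
  gives the exponent \<open>1 + e * p\<close>.\<close>

lemma power_step:
  fixes u v :: "'a::euclidean_space \<Rightarrow> real \<Rightarrow> ennreal"
  assumes sup: "supersolution D p T u v" and D: "D > 0" and p: "p > 0" and a: "a > 0"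
    and low: "lower_bound_on_balls z a T sqrt (\<lambda>s. m * s powr e) v" and m: "m \<ge> 0"
  shows "lower_bound_on_balls z (4 * a) T sqrt
    (\<lambda>t. (power_step_const DIM('a) D (real DIM('a) / 2 + e * p) * m powr p) * t powr (1 + e * p)) u"
proof (rule lower_bound_on_ballsI)
  let ?K = "spread_const DIM('a) D" and ?N = "real DIM('a)"
  define \<alpha> where "\<alpha> = ?N / 2 + e * p"
  have K: "?K > 0" using D by (simp add: spread_const_pos)
  show "AE t in lebesgue. a < t \<and> t < T \<longrightarrow> (AE x in lebesgue. x \<in> ball z (sqrt t) \<longrightarrow>
      (\<integral>\<^sup>+s\<in>{a<..<t / 2}. ennreal (?K * t powr (- ?N / 2) * s powr (?N / 2) * (m * s powr e) powr p) \<partial>lebesgue) \<le> u x t)"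
    using a m by (intro spread_lower_bound[OF sup D p _ low]) auto
  show "a \<le> 4 * a" using a by simp
  fix t assume t: "4 * a < t" "t < T"
  define w where "w = ?K * t powr (- ?N / 2) * (m powr p * (4 powr (- \<bar>\<alpha>\<bar>) * t powr \<alpha>))"
  have w: "w \<ge> 0" using K by (simp add: w_def)
  have "(power_step_const DIM('a) D \<alpha> * m powr p) * t powr (1 + e * p) = w * (t / 4)"
  proof -
    have "t powr (- ?N / 2) * t powr \<alpha> * t powr 1 = t powr (1 + e * p)"
    proof -
      have "- ?N / 2 + \<alpha> + 1 = 1 + e * p" by (simp add: \<alpha>_def)
      then show ?thesis by (simp only: powr_add[symmetric])
    qed
    then show ?thesis
      using t a by (simp add: w_def power_step_const_def mult_ac)
  qed
  then have "ennreal ((power_step_const DIM('a) D \<alpha> * m powr p) * t powr (1 + e * p)) = ennreal w * ennreal (t / 4)"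
    using w t a by (simp only: ennreal_mult)
  also have "ennreal w * ennreal (t / 4) = (\<integral>\<^sup>+s. ennreal w * indicator {t / 4<..<t / 2} s \<partial>lebesgue)"
    using t a by (simp add: nn_integral_cmult_indicator)
  also have "\<dots> \<le> (\<integral>\<^sup>+s\<in>{a<..<t / 2}. ennreal (?K * t powr (- ?N / 2) * s powr (?N / 2) * (m * s powr e) powr p) \<partial>lebesgue)"
  proof (rule nn_integral_mono)
    fix s
    show "ennreal w * indicator {t / 4<..<t / 2} s
      \<le> ennreal (?K * t powr (- ?N / 2) * s powr (?N / 2) * (m * s powr e) powr p) * indicator {a<..<t / 2} s"
    proof (cases "t / 4 < s \<and> s < t / 2")
      case True
      then have s: "s > 0" "a < s" using t a by auto
      have eq: "s powr (?N / 2) * (m * s powr e) powr p = m powr p * s powr \<alpha>"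
        using m by (simp add: powr_mult powr_powr powr_add mult_ac \<alpha>_def)
      have "4 powr (- \<bar>\<alpha>\<bar>) * t powr \<alpha> \<le> s powr \<alpha>"
      proof (cases "\<alpha> \<ge> 0")
        case True': True
        have "4 powr (- \<bar>\<alpha>\<bar>) * t powr \<alpha> = (t / 4) powr \<alpha>"
          using True' t a by (simp add: powr_divide powr_minus_divide)
        also have "\<dots> \<le> s powr \<alpha>" using True True' t a by (intro powr_mono2) auto
        finally show ?thesis .
      next
        case False
        have "4 powr (- \<bar>\<alpha>\<bar>) \<le> (1::real)" using powr_mono[of "-\<bar>\<alpha>\<bar>" 0 4] by simp
        then have "4 powr (- \<bar>\<alpha>\<bar>) * t powr \<alpha> \<le> t powr \<alpha>" by (simp add: mult_left_le_one_le)
        also have "\<dots> \<le> s powr \<alpha>" using True False t s by (intro powr_mono2') auto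
        finally show ?thesis .
      qed
      then have "w \<le> ?K * t powr (- ?N / 2) * (m powr p * s powr \<alpha>)"
        using K unfolding w_def by (intro mult_left_mono) auto
      also have "\<dots> = ?K * t powr (- ?N / 2) * s powr (?N / 2) * (m * s powr e) powr p"
        using eq by (simp add: mult.assoc)
      finally show ?thesis using True s by (simp add: ennreal_leI)
    qed simp
  qed
  finally show "ennreal ((power_step_const DIM('a) D (?N / 2 + e * p) * m powr p) * t powr (1 + e * p)) \<le>
    (\<integral>\<^sup>+s\<in>{a<..<t / 2}. ennreal (?K * t powr (- ?N / 2) * s powr (?N / 2) * (m * s powr e) powr p) \<partial>lebesgue)"
    unfolding \<alpha>_def .
qed

section \<open>The critical case\<close>

text \<open>Choose the logarithmic time \<open>l\<close> proportional to \<open>m powr (- \<kappa>)\<close> with the factor that makes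
  one step double \<open>m\<close>. While \<open>m \<le> C0\<close> the factor \<open>8\<close> costs no more than another multiple of
  \<open>m powr (- \<kappa>)\<close> in logarithmic time. Doubling \<open>m\<close> multiplies \<open>m powr (- \<kappa>)\<close> by
  \<open>\<delta> = 2 powr (- \<kappa>) < 1\<close>, so all doublings fit into a logarithmic time \<open>A * m powr (- \<kappa>)\<close>, the
  sum of a geometric series. If that ended before \<open>T / 2\<close>, the bound \<open>m \<le> C0\<close> would hold for all
  doublings. The relation \<open>R m a\<close> stands for: a profile of mass \<open>m\<close> is present from time \<open>a\<close>
  on.\<close>

lemma doubling_iteration:
  fixes c \<kappa> lam C0 :: real
  assumes c: "c > 0" and \<kappa>: "\<kappa> > 0" and lam: "lam > 0" and C0: "C0 > 0"
  obtains A where "A > 0" and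
    "\<And>R T m a. (\<And>m a a'. R m a \<Longrightarrow> a \<le> a' \<Longrightarrow> R m a') \<Longrightarrow>
      (\<And>m a l. 0 < m \<Longrightarrow> 0 < a \<Longrightarrow> 0 < l \<Longrightarrow> R m a \<Longrightarrow>
        R (c * m * (m powr \<kappa> * l) powr lam) (8 * a * exp (2 * l))) \<Longrightarrow>
      (\<And>m a. 0 < m \<Longrightarrow> 0 < a \<Longrightarrow> R m a \<Longrightarrow> a \<le> T / 2 \<Longrightarrow> m \<le> C0) \<Longrightarrow>
      0 < m \<Longrightarrow> 0 < a \<Longrightarrow> R m a \<Longrightarrow> T / 2 < a * exp (A * m powr (- \<kappa>))"
proof -
  define A0 where "A0 = (2 / c) powr (1 / lam)"
  have A0: "A0 > 0" using c by (simp add: A0_def)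
  have A0lam: "A0 powr lam = 2 / c" using c lam by (simp add: A0_def powr_powr)
  define A1 where "A1 = ln 8 * C0 powr \<kappa> + 2 * A0"
  have A1: "A1 > 0" using A0 C0 by (simp add: A1_def add_nonneg_pos)
  define \<delta> :: real where "\<delta> = 2 powr (- \<kappa>)"
  have \<delta>: "0 < \<delta>" "\<delta> < 1" using \<kappa> powr_less_mono[of "-\<kappa>" 0 2] by (auto simp: \<delta>_def)
  define A where "A = A1 / (1 - \<delta>)"
  have A: "A > 0" "A * (1 - \<delta>) = A1" using A1 \<delta> by (auto simp: A_def)
  have "T / 2 < a * exp (A * m powr (- \<kappa>))"
    if mono: "\<And>m a a'. R m a \<Longrightarrow> a \<le> a' \<Longrightarrow> R m a'"
      and step: "\<And>m a l. 0 < m \<Longrightarrow> 0 < a \<Longrightarrow> 0 < l \<Longrightarrow> R m a \<Longrightarrow> R (c * m * (m powr \<kappa> * l) powr lam) (8 * a * exp (2 * l))"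
      and bound: "\<And>m a. 0 < m \<Longrightarrow> 0 < a \<Longrightarrow> R m a \<Longrightarrow> a \<le> T / 2 \<Longrightarrow> m \<le> C0"
      and m: "0 < m" and a: "0 < a" and R: "R m a"
    for R :: "real \<Rightarrow> real \<Rightarrow> bool" and T m a
  proof (rule ccontr)
    assume "\<not> T / 2 < a * exp (A * m powr (- \<kappa>))"
    then have T: "a * exp (A * m powr (- \<kappa>)) \<le> T / 2" by simp
    define t where "t k = a * exp (A * m powr (- \<kappa>) * (1 - \<delta> ^ k))" for k :: nat
    have t0: "t k > 0" for k using a by (simp add: t_def)
    have tT: "t k \<le> T / 2" for k
    proof -
      have "A * m powr (- \<kappa>) * (1 - \<delta> ^ k) \<le> A * m powr (- \<kappa>)"
        using A \<delta> by (intro mult_left_le) auto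
      then have "t k \<le> a * exp (A * m powr (- \<kappa>))" unfolding t_def using a by (intro mult_left_mono) auto
      then show ?thesis using T by simp
    qed
    have all: "R (2 ^ k * m) (t k)" for k
    proof (induction k)
      case 0
      then show ?case using R by (simp add: t_def)
    next
      case (Suc k)
      define M where "M = 2 ^ k * m"
      have M: "M > 0" using m by (simp add: M_def)
      have MC: "M \<le> C0" using bound[OF _ t0 Suc.IH tT] M by (simp add: M_def)
      have M\<kappa>: "M powr (- \<kappa>) = m powr (- \<kappa>) * \<delta> ^ k"
      proof -
        have "(2 ^ k) powr (- \<kappa>) = \<delta> ^ k"
          by (simp add: \<delta>_def powr_realpow[symmetric] powr_powr mult.commute)
        then show ?thesis by (simp add: M_def powr_mult mult.commute)
      qed
      define l where "l = A0 * M powr (- \<kappa>)"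
      have l: "l > 0" using A0 M by (simp add: l_def)
      have "M powr \<kappa> * l = A0"
        using M by (simp add: l_def powr_add[symmetric])
      then have "c * M * (M powr \<kappa> * l) powr lam = 2 ^ Suc k * m"
        using c by (simp add: A0lam M_def)
      moreover have "R (c * M * (M powr \<kappa> * l) powr lam) (8 * t k * exp (2 * l))"
        using step[OF M t0 l] Suc.IH by (simp add: M_def)
      moreover have "8 * t k * exp (2 * l) \<le> t (Suc k)"
      proof -
        have "C0 powr (- \<kappa>) \<le> M powr (- \<kappa>)"
          using M MC \<kappa> by (intro powr_mono2') auto
        then have "C0 powr \<kappa> * C0 powr (- \<kappa>) \<le> C0 powr \<kappa> * M powr (- \<kappa>)"
          by (intro mult_left_mono) auto
        moreover have "C0 powr \<kappa> * C0 powr (- \<kappa>) = 1" using C0 by (simp add: powr_add[symmetric])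
        ultimately have "1 \<le> C0 powr \<kappa> * M powr (- \<kappa>)" by simp
        then have "ln 8 * 1 \<le> ln 8 * (C0 powr \<kappa> * M powr (- \<kappa>))"
          by (intro mult_left_mono) auto
        then have "ln 8 + 2 * l \<le> A1 * M powr (- \<kappa>)"
          by (simp add: A1_def l_def algebra_simps)
        also have "\<dots> = A * (1 - \<delta>) * (m powr (- \<kappa>) * \<delta> ^ k)" by (simp add: M\<kappa> A)
        finally have le: "ln 8 + 2 * l + A * m powr (- \<kappa>) * (1 - \<delta> ^ k) \<le> A * m powr (- \<kappa>) * (1 - \<delta> ^ Suc k)"
          by (simp add: algebra_simps)
        have "8 * t k * exp (2 * l) = a * exp (ln 8 + 2 * l + A * m powr (- \<kappa>) * (1 - \<delta> ^ k))"
          by (simp add: t_def exp_add)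
        also have "\<dots> \<le> t (Suc k)" unfolding t_def using le a by (intro mult_left_mono) auto
        finally show ?thesis .
      qed
      ultimately show ?case using mono by metis
    qed
    obtain k where "C0 / m < 2 ^ k" using real_arch_pow[of 2 "C0 / m"] by auto
    then have "C0 < 2 ^ k * m" using m by (simp add: field_simps)
    moreover have "2 ^ k * m \<le> C0" using bound[OF _ t0 all tT] m by simp
    ultimately show False by simp
  qed
  then show ?thesis by (rule that[OF A(1)])
qed

text \<open>With \<open>x = sqrt T / \<sigma> \<ge> 1\<close> the assumption says \<open>8 * x\<^sup>2 < exp (A * m powr (- \<kappa>))\<close>, and
  \<open>exp 1 + x \<le> 4 * x \<le> 8 * x\<^sup>2\<close>.\<close>

lemma log_bound_of_exp_bound:
  fixes A \<kappa> m T \<sigma> :: real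
  assumes A: "A > 0" and \<kappa>: "\<kappa> > 0" and m: "m > 0" and \<sigma>: "0 < \<sigma>" "\<sigma> \<le> sqrt T"
    and less: "T / 2 < \<sigma>\<^sup>2 / 16 * exp (A * m powr (- \<kappa>))"
  shows "m \<le> A powr (1 / \<kappa>) * ln (exp 1 + sqrt T / \<sigma>) powr (- 1 / \<kappa>)"
proof -
  define x where "x = sqrt T / \<sigma>"
  define L where "L = ln (exp 1 + x)"
  have x: "x \<ge> 1" using \<sigma> by (simp add: x_def)
  have T: "T > 0" using \<sigma> by (metis less_le_trans real_sqrt_gt_0_iff)
  have "8 * (T / \<sigma>\<^sup>2) < exp (A * m powr (- \<kappa>))"
    using less \<sigma> by (simp add: field_simps)
  moreover have "x\<^sup>2 = T / \<sigma>\<^sup>2" using T by (simp add: x_def power_divide)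
  ultimately have less': "8 * x\<^sup>2 < exp (A * m powr (- \<kappa>))" by simp
  have "exp 1 + x \<le> 3 * x + x" using x exp_le by linarith
  also have "\<dots> \<le> 8 * x\<^sup>2" using x by (simp add: power2_eq_square mult_left_mono)
  finally have "exp 1 + x < exp (A * m powr (- \<kappa>))" using less' by simp
  moreover have pos: "exp 1 + x > 0" using x by (simp add: add_pos_nonneg)
  ultimately have LA: "L < A * m powr (- \<kappa>)"
    unfolding L_def by (metis exp_gt_zero ln_exp ln_less_cancel_iff)
  have "1 < exp 1 + x" using x exp_gt_zero[of "1::real"] by linarith
  then have L: "L > 0" by (simp add: L_def)
  have "m powr \<kappa> * L \<le> m powr \<kappa> * (A * m powr (- \<kappa>))" using LA by (intro mult_left_mono) auto
  also have "\<dots> = A" using m by (simp add: powr_add[symmetric])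
  finally have "m powr \<kappa> \<le> A / L" using L by (simp add: field_simps)
  then have "(m powr \<kappa>) powr (1 / \<kappa>) \<le> (A / L) powr (1 / \<kappa>)"
    using \<kappa> by (intro powr_mono2) auto
  moreover have "(m powr \<kappa>) powr (1 / \<kappa>) = m" using m \<kappa> by (simp add: powr_powr)
  moreover have "(A / L) powr (1 / \<kappa>) = A powr (1 / \<kappa>) * L powr (- 1 / \<kappa>)"
    using powr_minus_divide[of L "1 / \<kappa>"] by (simp add: powr_divide)
  ultimately show ?thesis by (simp add: L_def x_def)
qed

text \<open>For \<open>b = N / 2\<close> the power of \<open>T\<close> in \<open>mass_bound\<close> disappears, so the mass of a profile is
  bounded by a constant; a gain \<open>step\<close> in logarithmic time then turns the constant into a power
  of the logarithm.\<close>

lemma critical_mass_bound_of_step: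
  fixes D1 D2 p q \<kappa> lam c :: real
  assumes D: "D1 > 0" "D2 > 0" and p: "p > 0" and q: "q > 0" and pq: "p * q > 1"
    and crit: "(q + 1) / (p * q - 1) = real DIM('a::euclidean_space) / 2"
    and c: "c > 0" and \<kappa>: "\<kappa> > 0" and lam: "lam > 0"
    and step: "\<And>T (u :: 'a \<Rightarrow> real \<Rightarrow> ennreal) v z m a l.
      supersolution D1 p T u v \<Longrightarrow> supersolution D2 q T v u \<Longrightarrow> 0 < m \<Longrightarrow> 0 < a \<Longrightarrow> 0 < l \<Longrightarrow>
      lower_bound_on_balls z a T sqrt (\<lambda>t. m * t powr (- real DIM('a) / 2)) v \<Longrightarrow>
      lower_bound_on_balls z (8 * a * exp (2 * l)) T sqrt
        (\<lambda>t. (c * m * (m powr \<kappa> * l) powr lam) * t powr (- real DIM('a) / 2)) v"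
  shows "\<exists>C>0. \<forall>T (u :: 'a \<Rightarrow> real \<Rightarrow> ennreal) v z \<sigma> m.
    supersolution D1 p T u v \<longrightarrow> supersolution D2 q T v u \<longrightarrow> 0 < \<sigma> \<longrightarrow> \<sigma> \<le> sqrt T \<longrightarrow> 0 < m \<longrightarrow>
    lower_bound_on_balls z (\<sigma>\<^sup>2 / 16) T sqrt (\<lambda>t. m * t powr (- real DIM('a) / 2)) v \<longrightarrow>
    m \<le> C * ln (exp 1 + sqrt T / \<sigma>) powr (- 1 / \<kappa>)"
proof -
  obtain C0 where C0: "C0 > 0" and bound: "\<And>T (u :: 'a \<Rightarrow> real \<Rightarrow> ennreal) v z a m.
    supersolution D1 p T u v \<Longrightarrow> supersolution D2 q T v u \<Longrightarrow> 0 < T \<Longrightarrow> a \<le> T / 2 \<Longrightarrow> 0 < m \<Longrightarrow>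
    lower_bound_on_balls z a T sqrt (\<lambda>t. m * t powr (- real DIM('a) / 2)) v \<Longrightarrow>
    m \<le> C0 * T powr (real DIM('a) / 2 - (q + 1) / (p * q - 1))"
    using mass_bound[OF D p q pq, where 'a = 'a] by blast
  obtain A where A: "A > 0" and iter: "\<And>R T m a. (\<And>m a a'. R m a \<Longrightarrow> a \<le> a' \<Longrightarrow> R m a') \<Longrightarrow>
      (\<And>m a l. 0 < m \<Longrightarrow> 0 < a \<Longrightarrow> 0 < l \<Longrightarrow> R m a \<Longrightarrow>
        R (c * m * (m powr \<kappa> * l) powr lam) (8 * a * exp (2 * l))) \<Longrightarrow>
      (\<And>m a. 0 < m \<Longrightarrow> 0 < a \<Longrightarrow> R m a \<Longrightarrow> a \<le> T / 2 \<Longrightarrow> m \<le> C0) \<Longrightarrow>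
      0 < m \<Longrightarrow> 0 < a \<Longrightarrow> R m a \<Longrightarrow> T / 2 < a * exp (A * m powr (- \<kappa>))"
    by (fact doubling_iteration[OF c \<kappa> lam C0])
  have "m \<le> A powr (1 / \<kappa>) * ln (exp 1 + sqrt T / \<sigma>) powr (- 1 / \<kappa>)"
    if sup: "supersolution D1 p T u v" "supersolution D2 q T v u" and \<sigma>: "0 < \<sigma>" "\<sigma> \<le> sqrt T" and m: "0 < m"
      and low: "lower_bound_on_balls z (\<sigma>\<^sup>2 / 16) T sqrt (\<lambda>t. m * t powr (- real DIM('a) / 2)) v"
    for T and u v :: "'a \<Rightarrow> real \<Rightarrow> ennreal" and z \<sigma> m
  proof -
    have T: "T > 0" using \<sigma> by (metis less_le_trans real_sqrt_gt_0_iff)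
    define R where "R m a \<longleftrightarrow> lower_bound_on_balls z a T sqrt (\<lambda>t. m * t powr (- real DIM('a) / 2)) v" for m a
    have "T / 2 < \<sigma>\<^sup>2 / 16 * exp (A * m powr (- \<kappa>))"
    proof (rule iter[of R])
      show "R m a'" if "R m a" "a \<le> a'" for m a a'
        using that(1) unfolding R_def by (rule lower_bound_on_balls_mono) (use that in auto)
      show "R (c * m * (m powr \<kappa> * l) powr lam) (8 * a * exp (2 * l))"
        if "0 < m" "0 < a" "0 < l" "R m a" for m a l
        using step[OF sup that(1-3)] that(4) unfolding R_def by simp
      show "m \<le> C0" if "0 < m" "0 < a" "R m a" "a \<le> T / 2" for m a
        using bound[OF sup T that(4) that(1)] that(3) T unfolding R_def by (simp add: crit)
    qed (use low m \<sigma> in \<open>auto simp: R_def\<close>)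
    then show ?thesis using A \<kappa> m \<sigma> by (intro log_bound_of_exp_bound)
  qed
  then show ?thesis using A by (intro exI[of _ "A powr (1 / \<kappa>)"]) auto
qed

text \<open>The profile of \<open>u\<close> is a power of \<open>t\<close> and only \<open>v\<close> gains a logarithm: the exponent identity
  \<open>e'\<close> is the critical relation in disguise.\<close>

lemma critical_mass_bound:
  fixes D1 D2 p q :: real
  assumes D: "D1 > 0" "D2 > 0" and p: "p > 0" and q: "q > 0" and pq: "p * q > 1"
    and crit: "(q + 1) / (p * q - 1) = real DIM('a::euclidean_space) / 2"
  shows "\<exists>C>0. \<forall>T (u :: 'a \<Rightarrow> real \<Rightarrow> ennreal) v z \<sigma> m.
    supersolution D1 p T u v \<longrightarrow> supersolution D2 q T v u \<longrightarrow> 0 < \<sigma> \<longrightarrow> \<sigma> \<le> sqrt T \<longrightarrow> 0 < m \<longrightarrow>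
    lower_bound_on_balls z (\<sigma>\<^sup>2 / 16) T sqrt (\<lambda>t. m * t powr (- real DIM('a) / 2)) v \<longrightarrow>
    m \<le> C * ln (exp 1 + sqrt T / \<sigma>) powr (- 1 / (p * q - 1))"
proof -
  let ?N = "real DIM('a)"
  define e where "e = - ?N / 2"
  define c1 where "c1 = power_step_const ?N D1 (?N / 2 + e * p)"
  define c2 where "c2 = spread_const ?N D2"
  have c: "c1 > 0" "c2 > 0" using D by (simp_all add: c1_def c2_def power_step_const_pos spread_const_pos)
  have e': "?N / 2 + (1 + e * p) * q = - 1"
    using crit pq by (simp add: e_def field_simps)
  show ?thesis
  proof (rule critical_mass_bound_of_step[OF D p q pq crit, where c = "c2 * c1 powr q" and lam = 1])
    fix T and u v :: "'a \<Rightarrow> real \<Rightarrow> ennreal" and z :: 'a and m a l :: real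
    assume sup: "supersolution D1 p T u v" "supersolution D2 q T v u" and m: "0 < m" and a: "0 < a" and l: "0 < l"
      and low: "lower_bound_on_balls z a T sqrt (\<lambda>t. m * t powr (- ?N / 2)) v"
    have "lower_bound_on_balls z (4 * a) T sqrt (\<lambda>t. (c1 * m powr p) * t powr (1 + e * p)) u"
      using low m a D p unfolding c1_def e_def by (intro power_step[OF sup(1)]) auto
    then have "lower_bound_on_balls z (2 * (4 * a) * exp l) T sqrt
        (\<lambda>t. (c2 * (c1 * m powr p) powr q * l) * t powr (- ?N / 2)) v"
      using m a l c e' q D unfolding c2_def by (intro log_step[OF sup(2)]) auto
    moreover have "2 * (4 * a) * exp l \<le> 8 * a * exp (2 * l)" using a l by simp
    moreover have "c2 * (c1 * m powr p) powr q * l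
        = c2 * c1 powr q * m * (m powr (p * q - 1) * l) powr 1"
    proof -
      have "m powr (p * q) = m * m powr (p * q - 1)"
        using powr_add[of m 1 "p * q - 1"] m by simp
      then show ?thesis using m l by (simp add: powr_mult powr_powr mult_ac)
    qed
    ultimately show "lower_bound_on_balls z (8 * a * exp (2 * l)) T sqrt
        (\<lambda>t. (c2 * c1 powr q * m * (m powr (p * q - 1) * l) powr 1) * t powr (- ?N / 2)) v"
      by (auto elim: lower_bound_on_balls_mono)
  qed (use c pq in auto)
qed

text \<open>Here both components satisfy the hypothesis of \<open>log_step\<close>, since the critical relation
  reduces to \<open>q = 1 + 2 / N\<close>. The additional logarithm in \<open>u\<close> leads to the better exponent
  \<open>1 / (q - 1) = N / 2\<close>.\<close>

lemma critical_mass_bound_equal_exponents: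
  fixes D1 D2 q :: real
  assumes D: "D1 > 0" "D2 > 0" and q: "q > 0" and pq: "q * q > 1"
    and crit: "(q + 1) / (q * q - 1) = real DIM('a::euclidean_space) / 2"
  shows "\<exists>C>0. \<forall>T (u :: 'a \<Rightarrow> real \<Rightarrow> ennreal) v z \<sigma> m.
    supersolution D1 q T u v \<longrightarrow> supersolution D2 q T v u \<longrightarrow> 0 < \<sigma> \<longrightarrow> \<sigma> \<le> sqrt T \<longrightarrow> 0 < m \<longrightarrow>
    lower_bound_on_balls z (\<sigma>\<^sup>2 / 16) T sqrt (\<lambda>t. m * t powr (- real DIM('a) / 2)) v \<longrightarrow>
    m \<le> C * ln (exp 1 + sqrt T / \<sigma>) powr (- real DIM('a) / 2)"
proof -
  let ?N = "real DIM('a)"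
  have q1: "q > 1"
  proof (rule ccontr)
    assume "\<not> q > 1"
    then have "q * q \<le> 1 * 1" using q by (intro mult_mono) auto
    then show False using pq by simp
  qed
  have "q * q - 1 = (q + 1) * (q - 1)" by (simp add: algebra_simps)
  then have crit': "1 / (q - 1) = ?N / 2" using crit q1 by simp
  then have e: "?N / 2 + (- ?N / 2) * q = - 1" using q1 by (simp add: field_simps)
  define c1 where "c1 = spread_const ?N D1"
  define c2 where "c2 = spread_const ?N D2"
  have c: "c1 > 0" "c2 > 0" using D by (simp_all add: c1_def c2_def spread_const_pos)
  have "\<exists>C>0. \<forall>T (u :: 'a \<Rightarrow> real \<Rightarrow> ennreal) v z \<sigma> m.
    supersolution D1 q T u v \<longrightarrow> supersolution D2 q T v u \<longrightarrow> 0 < \<sigma> \<longrightarrow> \<sigma> \<le> sqrt T \<longrightarrow> 0 < m \<longrightarrow>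
    lower_bound_on_balls z (\<sigma>\<^sup>2 / 16) T sqrt (\<lambda>t. m * t powr (- real DIM('a) / 2)) v \<longrightarrow>
    m \<le> C * ln (exp 1 + sqrt T / \<sigma>) powr (- 1 / (q - 1))"
  proof (rule critical_mass_bound_of_step[OF D q q pq crit, where c = "c2 * c1 powr q" and lam = "q + 1"])
    fix T and u v :: "'a \<Rightarrow> real \<Rightarrow> ennreal" and z :: 'a and m a l :: real
    assume sup: "supersolution D1 q T u v" "supersolution D2 q T v u" and m: "0 < m" and a: "0 < a" and l: "0 < l"
      and low: "lower_bound_on_balls z a T sqrt (\<lambda>t. m * t powr (- ?N / 2)) v"
    have "lower_bound_on_balls z (2 * a * exp l) T sqrt (\<lambda>t. (c1 * m powr q * l) * t powr (- ?N / 2)) u"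
      using low m a l D q e unfolding c1_def by (intro log_step[OF sup(1)]) auto
    then have "lower_bound_on_balls z (2 * (2 * a * exp l) * exp l) T sqrt
        (\<lambda>t. (c2 * (c1 * m powr q * l) powr q * l) * t powr (- ?N / 2)) v"
      using m a l c e q D unfolding c2_def by (intro log_step[OF sup(2)]) auto
    moreover have "2 * (2 * a * exp l) * exp l \<le> 8 * a * exp (2 * l)"
      using a by (simp add: exp_double power2_eq_square)
    moreover have "c2 * (c1 * m powr q * l) powr q * l
        = c2 * c1 powr q * m * (m powr (q - 1) * l) powr (q + 1)"
    proof -
      have "m powr (q * q) = m * (m powr (q - 1)) powr (q + 1)"
        using powr_add[of m 1 "(q - 1) * (q + 1)"] m by (simp add: powr_powr algebra_simps)
      then show ?thesis using m l by (simp add: powr_mult powr_powr powr_add mult_ac)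
    qed
    ultimately show "lower_bound_on_balls z (8 * a * exp (2 * l)) T sqrt
        (\<lambda>t. (c2 * c1 powr q * m * (m powr (q - 1) * l) powr (q + 1)) * t powr (- ?N / 2)) v"
      by (auto elim: lower_bound_on_balls_mono)
  qed (use c q q1 in auto)
  moreover have "- 1 / (q - 1) = - ?N / 2" using crit' by simp
  ultimately show ?thesis by (simp only:)
qed

section \<open>Profiles generated by the initial data\<close>

text \<open>Lower bound for \<open>t powr (N / 2)\<close> times the heat kernel that transports mass between times
  \<open>0\<close> and \<open>t\<close>, the distances being at most \<open>K * sqrt t\<close>. The factor \<open>2\<close> in place of \<open>4\<close> in the
  exponent is inherited from \<open>initial_trace_lower_bound\<close>.\<close>

definition trace_const :: "real \<Rightarrow> real \<Rightarrow> real \<Rightarrow> real" where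
  "trace_const N D K = (4 * pi * D) powr (- N / 2) * exp (- K\<^sup>2 / (2 * D))"

lemma trace_const_pos: "D > 0 \<Longrightarrow> trace_const N D K > 0"
  by (simp add: trace_const_def)

lemma trace_const_le:
  assumes "D > 0" and "t > 0" and "0 \<le> d" and "d \<le> K * sqrt t" and "N \<ge> 0"
  shows "trace_const N D K * t powr (- N / 2)
    \<le> (4 * pi * (D * t)) powr (- N / 2) * exp (- d\<^sup>2 / (2 * (D * t)))"
proof -
  have "d\<^sup>2 \<le> (K * sqrt t)\<^sup>2" using assms by (intro power_mono) auto
  then have "d\<^sup>2 \<le> K\<^sup>2 * t" using assms by (simp add: power_mult_distrib)
  then have "d\<^sup>2 / (2 * (D * t)) \<le> K\<^sup>2 * t / (2 * (D * t))"
    using assms by (intro divide_right_mono) auto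
  also have "\<dots> = K\<^sup>2 / (2 * D)" using assms by simp
  finally have "exp (- K\<^sup>2 / (2 * D)) \<le> exp (- d\<^sup>2 / (2 * (D * t)))" by simp
  then have "((4 * pi * D) powr (- N / 2) * t powr (- N / 2)) * exp (- K\<^sup>2 / (2 * D))
      \<le> ((4 * pi * D) powr (- N / 2) * t powr (- N / 2)) * exp (- d\<^sup>2 / (2 * (D * t)))"
    by (rule mult_left_mono) simp
  moreover have "(4 * pi * (D * t)) powr (- N / 2) = (4 * pi * D) powr (- N / 2) * t powr (- N / 2)"
    by (metis mult.assoc powr_mult)
  moreover have "trace_const N D K * t powr (- N / 2)
      = ((4 * pi * D) powr (- N / 2) * t powr (- N / 2)) * exp (- K\<^sup>2 / (2 * D))"
    by (simp only: trace_const_def mult.assoc mult.commute[of "exp _"])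
  ultimately show ?thesis by (simp only:)
qed

text \<open>For \<open>t > \<sigma>\<^sup>2 / 16\<close> one has \<open>\<sigma> < 4 * sqrt t\<close>; this gives the distance \<open>9 * sqrt t\<close>.
  Starting well before \<open>\<sigma>\<^sup>2\<close> makes \<open>\<sigma> = sqrt T\<close> admissible, because the profile is then present
  long before \<open>T\<close>.\<close>

lemma initial_mass_lower_bound:
  fixes u v :: "'a::euclidean_space \<Rightarrow> real \<Rightarrow> ennreal"
  assumes sup: "supersolution D p T u v" and D: "D > 0"
    and trace: "has_initial_trace u \<mu>" and radon: "radon_measure \<mu>"
    and \<sigma>: "\<sigma> > 0" and m: "0 \<le> m" "ennreal m \<le> emeasure \<mu> (ball z \<sigma>)"
  shows "lower_bound_on_balls z (\<sigma>\<^sup>2 / 16) T sqrt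
    (\<lambda>t. (trace_const DIM('a) D 9 * m) * t powr (- real DIM('a) / 2)) u"
  unfolding lower_bound_on_balls_def
  using initial_trace_lower_bound[OF sup D trace radon]
proof eventually_elim
  case (elim t)
  let ?N = "real DIM('a)"
  show ?case
  proof
    assume t: "\<sigma>\<^sup>2 / 16 < t \<and> t < T"
    have "0 < \<sigma>\<^sup>2 / 16" using \<sigma> by simp
    then have t0: "t > 0" using t by linarith
    have "\<sigma>\<^sup>2 < (4 * sqrt t)\<^sup>2" using t t0 by (simp add: power_mult_distrib)
    then have \<sigma>t: "\<sigma> < 4 * sqrt t" by (rule power_less_imp_less_base) (use t0 in simp)
    have "AE x in lebesgue. \<forall>z r. 0 < r \<longrightarrow>
      ennreal ((4 * pi * (D * t)) powr (- ?N / 2) * exp (- (norm (x - z) + 2 * r)\<^sup>2 / (2 * (D * t))))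
      * emeasure \<mu> (ball z r) \<le> u x t"
      using elim t t0 by simp
    then show "AE x in lebesgue. x \<in> ball z (sqrt t) \<longrightarrow>
      ennreal ((trace_const ?N D 9 * m) * t powr (- ?N / 2)) \<le> u x t"
    proof (eventually_elim, intro impI)
      fix x
      assume le: "\<forall>z r. 0 < r \<longrightarrow>
        ennreal ((4 * pi * (D * t)) powr (- ?N / 2) * exp (- (norm (x - z) + 2 * r)\<^sup>2 / (2 * (D * t))))
        * emeasure \<mu> (ball z r) \<le> u x t"
        and x: "x \<in> ball z (sqrt t)"
      have "norm (x - z) < sqrt t" using x by (simp add: dist_norm norm_minus_commute)
      then have "norm (x - z) + 2 * \<sigma> \<le> 9 * sqrt t" using \<sigma>t by linarith
      then have k: "trace_const ?N D 9 * t powr (- ?N / 2)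
        \<le> (4 * pi * (D * t)) powr (- ?N / 2) * exp (- (norm (x - z) + 2 * \<sigma>)\<^sup>2 / (2 * (D * t)))"
        using D t0 \<sigma> by (intro trace_const_le) auto
      have "(trace_const ?N D 9 * m) * t powr (- ?N / 2) = (trace_const ?N D 9 * t powr (- ?N / 2)) * m"
        by (simp only: mult_ac)
      then have "ennreal ((trace_const ?N D 9 * m) * t powr (- ?N / 2))
          = ennreal (trace_const ?N D 9 * t powr (- ?N / 2)) * ennreal m"
        using m D trace_const_pos[OF D, of ?N 9] by (simp only: ennreal_mult less_imp_le mult_nonneg_nonneg powr_ge_zero)
      also have "\<dots> \<le> ennreal ((4 * pi * (D * t)) powr (- ?N / 2) * exp (- (norm (x - z) + 2 * \<sigma>)\<^sup>2 / (2 * (D * t))))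
        * emeasure \<mu> (ball z \<sigma>)"
        by (rule mult_mono[OF ennreal_leI[OF k] m(2)]) auto
      also have "\<dots> \<le> u x t" using le \<sigma> by blast
      finally show "ennreal ((trace_const ?N D 9 * m) * t powr (- ?N / 2)) \<le> u x t" .
    qed
  qed
qed

lemma radon_ball_emeasure:
  "radon_measure \<mu> \<Longrightarrow> emeasure \<mu> (ball z r) = ennreal (measure \<mu> (ball z r))"
proof -
  assume radon: "radon_measure \<mu>"
  have "emeasure \<mu> (ball z r) \<le> emeasure \<mu> (cball z r)"
    using radon by (intro emeasure_mono) (auto simp: radon_measure_def)
  also have "\<dots> < \<infinity>" using radon by (simp add: radon_measure_def)
  finally show "emeasure \<mu> (ball z r) = ennreal (measure \<mu> (ball z r))"
    by (intro emeasure_eq_ennreal_measure) simp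
qed

lemma borel_measurable_measure_ball:
  assumes "radon_measure \<mu>"
  shows "(\<lambda>r. measure \<mu> (ball z r)) \<in> borel_measurable borel"
proof (rule borel_measurable_mono)
  show "mono (\<lambda>r. measure \<mu> (ball z r))"
  proof (rule monoI)
    fix r r' :: real assume "r \<le> r'"
    then have "emeasure \<mu> (ball z r) \<le> emeasure \<mu> (ball z r')"
      using assms by (intro emeasure_mono) (auto simp: radon_measure_def)
    then show "measure \<mu> (ball z r) \<le> measure \<mu> (ball z r')"
      by (simp add: radon_ball_emeasure[OF assms])
  qed
qed

text \<open>The radius \<open>8 * sqrt s\<close> is larger than \<open>sqrt s\<close> so that the times \<open>s \<le> \<sigma>\<^sup>2 / 64\<close> already
  see all radii up to \<open>\<sigma>\<close>. The distance is at most \<open>sqrt s + 16 * sqrt s\<close>.\<close>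

lemma initial_profile_lower_bound:
  fixes u v :: "'a::euclidean_space \<Rightarrow> real \<Rightarrow> ennreal"
  assumes sup: "supersolution D p T u v" and D: "D > 0"
    and trace: "has_initial_trace u \<mu>" and radon: "radon_measure \<mu>"
  shows "lower_bound_on_balls z 0 T sqrt
    (\<lambda>s. trace_const DIM('a) D 17 * measure \<mu> (ball z (8 * sqrt s)) * s powr (- real DIM('a) / 2)) u"
  unfolding lower_bound_on_balls_def
  using initial_trace_lower_bound[OF sup D trace radon]
proof eventually_elim
  case (elim t)
  let ?N = "real DIM('a)"
  show ?case
  proof
    assume t: "0 < t \<and> t < T"
    let ?m = "measure \<mu> (ball z (8 * sqrt t))"
    note m = radon_ball_emeasure[OF radon, of z "8 * sqrt t"]
    have "AE x in lebesgue. \<forall>z r. 0 < r \<longrightarrow>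
      ennreal ((4 * pi * (D * t)) powr (- ?N / 2) * exp (- (norm (x - z) + 2 * r)\<^sup>2 / (2 * (D * t))))
      * emeasure \<mu> (ball z r) \<le> u x t"
      using elim t by simp
    then show "AE x in lebesgue. x \<in> ball z (sqrt t) \<longrightarrow>
      ennreal (trace_const ?N D 17 * ?m * t powr (- ?N / 2)) \<le> u x t"
    proof (eventually_elim, intro impI)
      fix x
      assume le: "\<forall>z r. 0 < r \<longrightarrow>
        ennreal ((4 * pi * (D * t)) powr (- ?N / 2) * exp (- (norm (x - z) + 2 * r)\<^sup>2 / (2 * (D * t))))
        * emeasure \<mu> (ball z r) \<le> u x t"
        and x: "x \<in> ball z (sqrt t)"
      have "norm (x - z) < sqrt t" using x by (simp add: dist_norm norm_minus_commute)
      then have "norm (x - z) + 2 * (8 * sqrt t) \<le> 17 * sqrt t" by linarith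
      then have k: "trace_const ?N D 17 * t powr (- ?N / 2)
        \<le> (4 * pi * (D * t)) powr (- ?N / 2) * exp (- (norm (x - z) + 2 * (8 * sqrt t))\<^sup>2 / (2 * (D * t)))"
        using D t by (intro trace_const_le) auto
      have "trace_const ?N D 17 * ?m * t powr (- ?N / 2) = (trace_const ?N D 17 * t powr (- ?N / 2)) * ?m"
        by (simp only: mult_ac)
      then have "ennreal (trace_const ?N D 17 * ?m * t powr (- ?N / 2))
          = ennreal (trace_const ?N D 17 * t powr (- ?N / 2)) * ennreal ?m"
        using trace_const_pos[OF D, of ?N 17]
        by (simp only: ennreal_mult less_imp_le mult_nonneg_nonneg powr_ge_zero measure_nonneg)
      also have "\<dots> \<le> ennreal ((4 * pi * (D * t)) powr (- ?N / 2) * exp (- (norm (x - z) + 2 * (8 * sqrt t))\<^sup>2 / (2 * (D * t))))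
        * emeasure \<mu> (ball z (8 * sqrt t))"
        unfolding m by (rule mult_right_mono[OF ennreal_leI[OF k]]) simp
      also have "\<dots> \<le> u x t" using t by (intro le[rule_format]) simp
      finally show "ennreal (trace_const ?N D 17 * ?m * t powr (- ?N / 2)) \<le> u x t" .
    qed
  qed
qed

text \<open>The substitution \<open>s = \<tau>\<^sup>2 / 64\<close>. The exponent on the right comes from
  \<open>\<tau> powr (N - N q) * \<tau> = \<tau> powr (-1) * (\<tau> powr (- (N - (N + 2) / q))) powr q\<close>.\<close>

lemma ball_profile_substitution:
  fixes \<mu> :: "'a::euclidean_space measure"
  assumes radon: "radon_measure \<mu>" and \<sigma>: "\<sigma> > 0" and q: "q > 0"
  shows "(\<integral>\<^sup>+s\<in>{0<..<\<sigma>\<^sup>2 / 64}. ennreal (s powr (N / 2) * (measure \<mu> (ball z (8 * sqrt s)) * s powr (- N / 2)) powr q) \<partial>lebesgue)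
    = ennreal (8 powr (N * q - N) / 32) *
      (\<integral>\<^sup>+\<tau>\<in>{0<..<\<sigma>}. ennreal (1 / \<tau>) *
        ennpowr (emeasure \<mu> (ball z \<tau>) / ennreal (\<tau> powr (N - (N + 2) / q))) q \<partial>lborel)"
proof -
  define M where "M r = measure \<mu> (ball z r)" for r
  have M[measurable]: "M \<in> borel_measurable borel"
    unfolding M_def by (rule borel_measurable_measure_ball[OF radon])
  have M0: "M r \<ge> 0" for r by (simp add: M_def)
  define F where "F s = s powr (N / 2) * (M (8 * sqrt s) * s powr (- N / 2)) powr q" for s
  have Fm[measurable]: "F \<in> borel_measurable borel" unfolding F_def by measurable
  define g where "g \<tau> = \<tau>\<^sup>2 / 64" for \<tau> :: real
  have "(\<integral>\<^sup>+s\<in>{0<..<\<sigma>\<^sup>2 / 64}. ennreal (F s) \<partial>lebesgue) = (\<integral>\<^sup>+s\<in>{0<..<\<sigma>\<^sup>2 / 64}. ennreal (F s) \<partial>lborel)"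
    by (rule nn_integral_completion)
  also have "\<dots> = (\<integral>\<^sup>+s. ennreal (F s * indicator {g 0..g \<sigma>} s) \<partial>lborel)"
  proof (rule nn_integral_cong_AE)
    have "AE s in lborel. s \<noteq> (0::real)" "AE s in lborel. s \<noteq> \<sigma>\<^sup>2 / 64" by (rule AE_lborel_singleton)+
    then show "AE s in lborel. ennreal (F s) * indicator {0<..<\<sigma>\<^sup>2 / 64} s = ennreal (F s * indicator {g 0..g \<sigma>} s)"
      by eventually_elim (auto simp: g_def split: split_indicator)
  qed
  also have "\<dots> = (\<integral>\<^sup>+\<tau>. ennreal (F (g \<tau>) * (\<tau> / 32) * indicator {0..\<sigma>} \<tau>) \<partial>lborel)"
  proof (rule nn_integral_substitution)
    show "set_borel_measurable borel {g 0..g \<sigma>} F"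
      unfolding set_borel_measurable_def by measurable
    show "(g has_real_derivative \<tau> / 32) (at \<tau>)" for \<tau>
      unfolding g_def by (auto intro!: derivative_eq_intros)
    show "continuous_on {0..\<sigma>} (\<lambda>\<tau>. \<tau> / 32)" by (intro continuous_intros) auto
  qed (use \<sigma> in auto)
  also have "\<dots> = (\<integral>\<^sup>+\<tau>. ennreal (8 powr (N * q - N) / 32) * (ennreal (1 / \<tau>) *
        ennpowr (emeasure \<mu> (ball z \<tau>) / ennreal (\<tau> powr (N - (N + 2) / q))) q * indicator {0<..<\<sigma>} \<tau>) \<partial>lborel)"
  proof (rule nn_integral_cong_AE)
    have "AE \<tau> in lborel. \<tau> \<noteq> (0::real)" "AE \<tau> in lborel. \<tau> \<noteq> \<sigma>" by (rule AE_lborel_singleton)+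
    then show "AE \<tau> in lborel. ennreal (F (g \<tau>) * (\<tau> / 32) * indicator {0..\<sigma>} \<tau>)
      = ennreal (8 powr (N * q - N) / 32) * (ennreal (1 / \<tau>) *
        ennpowr (emeasure \<mu> (ball z \<tau>) / ennreal (\<tau> powr (N - (N + 2) / q))) q * indicator {0<..<\<sigma>} \<tau>)"
    proof eventually_elim
      case (elim \<tau>)
      show ?case
      proof (cases "0 < \<tau> \<and> \<tau> < \<sigma>")
        case True
        then have \<tau>: "\<tau> > 0" by simp
        have "emeasure \<mu> (ball z \<tau>) / ennreal (\<tau> powr (N - (N + 2) / q)) = ennreal (M \<tau> / \<tau> powr (N - (N + 2) / q))"
          using \<tau> M0 by (simp add: radon_ball_emeasure[OF radon] M_def divide_ennreal)
        then have e1: "ennpowr (emeasure \<mu> (ball z \<tau>) / ennreal (\<tau> powr (N - (N + 2) / q))) q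
            = ennreal ((M \<tau> / \<tau> powr (N - (N + 2) / q)) powr q)"
          using M0 by (simp add: ennpowr_ennreal)
        have "(N - (N + 2) / q) * q = N * q - (N + 2)"
          using q by (simp add: left_diff_distrib)
        then have *: "(M \<tau> / \<tau> powr (N - (N + 2) / q)) powr q = M \<tau> powr q / \<tau> powr (N * q - (N + 2))"
          by (simp only: powr_divide powr_powr)
        have e2: "1 / \<tau> * (M \<tau> / \<tau> powr (N - (N + 2) / q)) powr q = M \<tau> powr q * \<tau> powr (N + 1 - N * q)"
        proof -
          have "1 / \<tau> = \<tau> powr (- 1)" using \<tau> by (simp add: powr_minus_divide)
          moreover have "1 / \<tau> powr (N * q - (N + 2)) = \<tau> powr (- (N * q - (N + 2)))"
            by (simp only: powr_minus_divide)
          ultimately have "1 / \<tau> * (M \<tau> powr q / \<tau> powr (N * q - (N + 2)))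
              = M \<tau> powr q * (\<tau> powr (- 1) * \<tau> powr (- (N * q - (N + 2))))"
            by (metis (no_types) mult.left_commute mult.right_neutral times_divide_eq_right)
          also have "\<tau> powr (- 1) * \<tau> powr (- (N * q - (N + 2))) = \<tau> powr (- 1 + - (N * q - (N + 2)))"
            by (simp only: powr_add)
          also have "- 1 + - (N * q - (N + 2)) = N + 1 - N * q" by simp
          finally show ?thesis by (simp only: *)
        qed
        have gp: "g \<tau> powr a = \<tau> powr (2 * a) * 8 powr (- (2 * a))" for a
        proof -
          have "g \<tau> = (\<tau> / 8) powr 2" using \<tau> by (simp add: g_def power_divide)
          then have "g \<tau> powr a = (\<tau> / 8) powr (2 * a)" by (simp add: powr_powr)
          also have "\<dots> = \<tau> powr (2 * a) * 8 powr (- (2 * a))"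
            by (simp add: powr_divide powr_minus_divide)
          finally show ?thesis .
        qed
        have "8 * sqrt (g \<tau>) = \<tau>" using \<tau> by (simp add: g_def real_sqrt_divide)
        then have "F (g \<tau>) = g \<tau> powr (N / 2) * (M \<tau> powr q * g \<tau> powr (- N / 2 * q))"
          by (simp add: F_def powr_mult powr_powr)
        also have "\<dots> = M \<tau> powr q * (g \<tau> powr (N / 2 + - N / 2 * q))"
          by (simp only: powr_add mult_ac)
        also have "g \<tau> powr (N / 2 + - N / 2 * q) = \<tau> powr (N - N * q) * 8 powr (N * q - N)"
          unfolding gp by (simp add: algebra_simps)
        finally have "F (g \<tau>) * (\<tau> / 32) = 8 powr (N * q - N) / 32 * (M \<tau> powr q * (\<tau> powr (N - N * q) * \<tau> powr 1))"
          using \<tau> by simp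
        also have "\<tau> powr (N - N * q) * \<tau> powr 1 = \<tau> powr (N - N * q + 1)"
          by (simp only: powr_add)
        also have "N - N * q + 1 = N + 1 - N * q" by simp
        finally have "F (g \<tau>) * (\<tau> / 32) = 8 powr (N * q - N) / 32 * (1 / \<tau> * (M \<tau> / \<tau> powr (N - (N + 2) / q)) powr q)"
          by (simp only: e2)
        then have "ennreal (F (g \<tau>) * (\<tau> / 32)) = ennreal (8 powr (N * q - N) / 32) *
            (ennreal (1 / \<tau>) * ennreal ((M \<tau> / \<tau> powr (N - (N + 2) / q)) powr q))"
          using \<tau> by (simp only: ennreal_mult[symmetric] powr_ge_zero mult_nonneg_nonneg divide_nonneg_nonneg
              zero_le_numeral zero_le_one less_imp_le)
        then show ?thesis using True by (simp add: e1)
      next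
        case False
        then have "\<tau> \<notin> {0..\<sigma>}" "\<tau> \<notin> {0<..<\<sigma>}" using elim by auto
        then show ?thesis by simp
      qed
    qed
  qed
  also have "\<dots> = ennreal (8 powr (N * q - N) / 32) * (\<integral>\<^sup>+\<tau>. (ennreal (1 / \<tau>) *
        ennpowr (emeasure \<mu> (ball z \<tau>) / ennreal (\<tau> powr (N - (N + 2) / q))) q * indicator {0<..<\<sigma>} \<tau>) \<partial>lborel)"
  proof (rule nn_integral_cmult)
    have "(\<lambda>\<tau>. ennreal (1 / \<tau>) * ennreal ((M \<tau> / \<tau> powr (N - (N + 2) / q)) powr q) * indicator {0<..<\<sigma>} \<tau>) \<in> borel_measurable lborel"
      by measurable
    also have "(\<lambda>\<tau>. ennreal (1 / \<tau>) * ennreal ((M \<tau> / \<tau> powr (N - (N + 2) / q)) powr q) * indicator {0<..<\<sigma>} \<tau>)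
      = (\<lambda>\<tau>. ennreal (1 / \<tau>) * ennpowr (emeasure \<mu> (ball z \<tau>) / ennreal (\<tau> powr (N - (N + 2) / q))) q * indicator {0<..<\<sigma>} \<tau>)"
      using M0 by (auto simp: fun_eq_iff radon_ball_emeasure[OF radon] M_def divide_ennreal ennpowr_ennreal split: split_indicator)
    finally show "(\<lambda>\<tau>. ennreal (1 / \<tau>) * ennpowr (emeasure \<mu> (ball z \<tau>) / ennreal (\<tau> powr (N - (N + 2) / q))) q * indicator {0<..<\<sigma>} \<tau>)
      \<in> borel_measurable lborel" .
  qed
  finally show ?thesis unfolding F_def M_def .
qed

definition source_const :: "real \<Rightarrow> real \<Rightarrow> real \<Rightarrow> real \<Rightarrow> real" where
  "source_const N D1 D2 q = spread_const N D2 * trace_const N D1 17 powr q * (8 powr (N * q - N) / 32)"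

lemma source_const_pos: "N \<ge> 0 \<Longrightarrow> D1 > 0 \<Longrightarrow> D2 > 0 \<Longrightarrow> source_const N D1 D2 q > 0"
  using trace_const_pos[of D1 N 17] by (simp add: source_const_def spread_const_pos)

text \<open>For \<open>t > \<sigma>\<^sup>2 / 16\<close> the times \<open>s < \<sigma>\<^sup>2 / 64\<close> are below \<open>t / 2\<close>, so the mass deposited by
  then has spread over the ball of radius \<open>sqrt t\<close>.\<close>

lemma initial_source_lower_bound:
  fixes u v :: "'a::euclidean_space \<Rightarrow> real \<Rightarrow> ennreal"
  assumes sup: "supersolution D1 p T u v" "supersolution D2 q T v u" and D: "D1 > 0" "D2 > 0" and q: "q > 0"
    and trace: "has_initial_trace u \<mu>" and radon: "radon_measure \<mu>" and \<sigma>: "\<sigma> > 0"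
    and m: "0 \<le> m" "ennreal m \<le> (\<integral>\<^sup>+\<tau>\<in>{0<..<\<sigma>}. ennreal (1 / \<tau>) *
        ennpowr (emeasure \<mu> (ball z \<tau>) / ennreal (\<tau> powr (real DIM('a) - (real DIM('a) + 2) / q))) q \<partial>lborel)"
  shows "lower_bound_on_balls z (\<sigma>\<^sup>2 / 16) T sqrt
    (\<lambda>t. (source_const DIM('a) D1 D2 q * m) * t powr (- real DIM('a) / 2)) v"
proof (rule lower_bound_on_ballsI)
  let ?N = "real DIM('a)" and ?K = "spread_const DIM('a) D2" and ?\<kappa> = "trace_const DIM('a) D1 17"
  let ?g = "\<lambda>s. ?\<kappa> * measure \<mu> (ball z (8 * sqrt s)) * s powr (- ?N / 2)"
  have K: "?K > 0" using D by (simp add: spread_const_pos)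
  have \<kappa>: "?\<kappa> > 0" using D by (simp add: trace_const_pos)
  show "AE t in lebesgue. 0 < t \<and> t < T \<longrightarrow> (AE x in lebesgue. x \<in> ball z (sqrt t) \<longrightarrow>
      (\<integral>\<^sup>+s\<in>{0<..<t / 2}. ennreal (?K * t powr (- ?N / 2) * s powr (?N / 2) * ?g s powr q) \<partial>lebesgue) \<le> v x t)"
    using \<kappa> by (intro spread_lower_bound[OF sup(2) D(2) q] initial_profile_lower_bound[OF sup(1) D(1) trace radon]) auto
  show "0 \<le> \<sigma>\<^sup>2 / 16" by simp
  fix t assume t: "\<sigma>\<^sup>2 / 16 < t" "t < T"
  let ?F = "\<lambda>s. s powr (?N / 2) * (measure \<mu> (ball z (8 * sqrt s)) * s powr (- ?N / 2)) powr q"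
  let ?w = "?K * ?\<kappa> powr q * t powr (- ?N / 2)"
  have w: "?w \<ge> 0" using K by simp
  have radon': "(\<lambda>s. measure \<mu> (ball z (8 * sqrt s))) \<in> borel_measurable borel"
    using borel_measurable_measure_ball[OF radon] by (rule measurable_compose[rotated]) measurable
  have "(source_const ?N D1 D2 q * m) * t powr (- ?N / 2) = ?w * ((8 powr (?N * q - ?N) / 32) * m)"
    by (simp only: source_const_def mult_ac)
  then have "ennreal ((source_const ?N D1 D2 q * m) * t powr (- ?N / 2))
      = ennreal (?w * ((8 powr (?N * q - ?N) / 32) * m))"
    by (simp only:)
  also have "\<dots> = ennreal ?w * ennreal ((8 powr (?N * q - ?N) / 32) * m)"
    by (rule ennreal_mult) (use w m(1) in auto)
  also have "ennreal ((8 powr (?N * q - ?N) / 32) * m) = ennreal (8 powr (?N * q - ?N) / 32) * ennreal m"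
    by (rule ennreal_mult) (use m(1) in auto)
  also have "ennreal ?w * (ennreal (8 powr (?N * q - ?N) / 32) * ennreal m) \<le> ennreal ?w * (\<integral>\<^sup>+s\<in>{0<..<\<sigma>\<^sup>2 / 64}. ennreal (?F s) \<partial>lebesgue)"
    unfolding ball_profile_substitution[OF radon \<sigma> q] using m by (intro mult_left_mono) auto
  also have "\<dots> = (\<integral>\<^sup>+s. ennreal ?w * (ennreal (?F s) * indicator {0<..<\<sigma>\<^sup>2 / 64} s) \<partial>lebesgue)"
  proof (rule nn_integral_cmult[symmetric])
    have "(\<lambda>s. ennreal (?F s) * indicator {0<..<\<sigma>\<^sup>2 / 64} s) \<in> borel_measurable borel"
      using radon' by measurable
    then show "(\<lambda>s. ennreal (?F s) * indicator {0<..<\<sigma>\<^sup>2 / 64} s) \<in> borel_measurable lebesgue"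
      by (intro measurable_completion) simp
  qed
  also have "\<dots> \<le> (\<integral>\<^sup>+s\<in>{0<..<t / 2}. ennreal (?K * t powr (- ?N / 2) * s powr (?N / 2) * ?g s powr q) \<partial>lebesgue)"
  proof (rule nn_integral_mono)
    fix s
    show "ennreal ?w * (ennreal (?F s) * indicator {0<..<\<sigma>\<^sup>2 / 64} s)
      \<le> ennreal (?K * t powr (- ?N / 2) * s powr (?N / 2) * ?g s powr q) * indicator {0<..<t / 2} s"
    proof (cases "0 < s \<and> s < \<sigma>\<^sup>2 / 64")
      case True
      then have "s < t / 2" using t by linarith
      moreover have "?w * ?F s = ?K * t powr (- ?N / 2) * s powr (?N / 2) * ?g s powr q"
        by (simp only: powr_mult mult_ac)
      then have "ennreal ?w * ennreal (?F s) = ennreal (?K * t powr (- ?N / 2) * s powr (?N / 2) * ?g s powr q)"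
        using w by (simp only: ennreal_mult[symmetric] powr_ge_zero mult_nonneg_nonneg)
      ultimately show ?thesis using True by simp
    qed auto
  qed
  finally show "ennreal ((source_const ?N D1 D2 q * m) * t powr (- ?N / 2))
    \<le> (\<integral>\<^sup>+s\<in>{0<..<t / 2}. ennreal (?K * t powr (- ?N / 2) * s powr (?N / 2) * ?g s powr q) \<partial>lebesgue)" .
qed

section \<open>Bounds for the initial traces\<close>

text
  \<open>The masses of profiles are real numbers, whereas the quantities to be bounded might a priori be infinite.\<close>

lemma ennreal_le_of_real_lower_bounds:
  assumes "\<And>m. 0 < m \<Longrightarrow> ennreal m \<le> A \<Longrightarrow> m \<le> B"
  shows "A \<le> ennreal B"
proof (rule ccontr)
  assume "\<not> A \<le> ennreal B"
  then have "ennreal B < A" by simp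
  then obtain c where c: "ennreal B < c" "c < A" using dense by blast
  then have "c < top" by (meson order_less_le_trans top_greatest)
  then obtain m where m: "0 \<le> m" "c = ennreal m" by (cases c) auto
  have "0 < m" using c m by (metis ennreal_eq_0_iff not_less_zero order_less_le)
  then have "m \<le> B" using assms[of m] c m by auto
  then have "c \<le> ennreal B" using m by (simp add: ennreal_leI)
  then show False using c by simp
qed

lemma initial_mass_le:
  fixes u v :: "'a::euclidean_space \<Rightarrow> real \<Rightarrow> ennreal"
  assumes sup: "supersolution D p T u v" and D: "D > 0"
    and trace: "has_initial_trace u \<mu>" and radon: "radon_measure \<mu>" and \<sigma>: "\<sigma> > 0"
    and bound: "\<And>z m. 0 < m \<Longrightarrow>
      lower_bound_on_balls z (\<sigma>\<^sup>2 / 16) T sqrt (\<lambda>t. m * t powr (- real DIM('a) / 2)) u \<Longrightarrow> m \<le> B"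
  shows "(SUP z. emeasure \<mu> (ball z \<sigma>)) \<le> ennreal (B / trace_const DIM('a) D 9)"
proof (rule SUP_least, rule ennreal_le_of_real_lower_bounds)
  fix z m assume m: "0 < m" "ennreal m \<le> emeasure \<mu> (ball z \<sigma>)"
  have k: "trace_const DIM('a) D 9 > 0" using D by (rule trace_const_pos)
  have "trace_const DIM('a) D 9 * m \<le> B"
    using m k by (intro bound[of _ z] initial_mass_lower_bound[OF sup D trace radon \<sigma>]) auto
  then show "m \<le> B / trace_const DIM('a) D 9" using k by (simp add: field_simps)
qed

text \<open>Any bound on the mass of profiles of \<open>v\<close> that start at time \<open>\<sigma>\<^sup>2 / 16\<close> bounds both
  quantities at once.\<close>

lemma initial_data_le:
  fixes u v :: "'a::euclidean_space \<Rightarrow> real \<Rightarrow> ennreal"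
  assumes sup: "supersolution D1 p T u v" "supersolution D2 q T v u" and D: "D1 > 0" "D2 > 0" and q: "q > 0"
    and \<mu>: "has_initial_trace u \<mu>" "radon_measure \<mu>" and \<nu>: "has_initial_trace v \<nu>" "radon_measure \<nu>"
    and \<sigma>: "\<sigma> > 0" and B: "B \<ge> 0"
    and bound: "\<And>z m. 0 < m \<Longrightarrow>
      lower_bound_on_balls z (\<sigma>\<^sup>2 / 16) T sqrt (\<lambda>t. m * t powr (- real DIM('a) / 2)) v \<Longrightarrow> m \<le> B"
  shows "(SUP x. \<integral>\<^sup>+\<tau>\<in>{0<..<\<sigma>}. ennreal (1 / \<tau>) *
        ennpowr (emeasure \<mu> (ball x \<tau>) / ennreal (\<tau> powr (real DIM('a) - (real DIM('a) + 2) / q))) q \<partial>lborel)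
      + (SUP x. emeasure \<nu> (ball x \<sigma>))
    \<le> ennreal ((1 / source_const DIM('a) D1 D2 q + 1 / trace_const DIM('a) D2 9) * B)"
proof -
  let ?s = "source_const DIM('a) D1 D2 q" and ?k = "trace_const DIM('a) D2 9"
  have s: "?s > 0" using D by (simp add: source_const_pos)
  have k: "?k > 0" using D by (simp add: trace_const_pos)
  have "(SUP x. \<integral>\<^sup>+\<tau>\<in>{0<..<\<sigma>}. ennreal (1 / \<tau>) *
        ennpowr (emeasure \<mu> (ball x \<tau>) / ennreal (\<tau> powr (real DIM('a) - (real DIM('a) + 2) / q))) q \<partial>lborel)
      \<le> ennreal (B / ?s)"
  proof (rule SUP_least, rule ennreal_le_of_real_lower_bounds)
    fix z m assume m: "0 < m" "ennreal m \<le> (\<integral>\<^sup>+\<tau>\<in>{0<..<\<sigma>}. ennreal (1 / \<tau>) *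
        ennpowr (emeasure \<mu> (ball z \<tau>) / ennreal (\<tau> powr (real DIM('a) - (real DIM('a) + 2) / q))) q \<partial>lborel)"
    have "?s * m \<le> B"
      using m s by (intro bound[of _ z] initial_source_lower_bound[OF sup D q \<mu> \<sigma>]) auto
    then show "m \<le> B / ?s" using s by (simp add: field_simps)
  qed
  moreover have "(SUP x. emeasure \<nu> (ball x \<sigma>)) \<le> ennreal (B / ?k)"
    using bound by (rule initial_mass_le[OF sup(2) D(2) \<nu> \<sigma>])
  ultimately have "(SUP x. \<integral>\<^sup>+\<tau>\<in>{0<..<\<sigma>}. ennreal (1 / \<tau>) *
        ennpowr (emeasure \<mu> (ball x \<tau>) / ennreal (\<tau> powr (real DIM('a) - (real DIM('a) + 2) / q))) q \<partial>lborel)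
      + (SUP x. emeasure \<nu> (ball x \<sigma>)) \<le> ennreal (B / ?s) + ennreal (B / ?k)"
    by (rule add_mono)
  also have "\<dots> = ennreal (B / ?s + B / ?k)" using s k B by (simp add: ennreal_plus)
  also have "B / ?s + B / ?k = (1 / ?s + 1 / ?k) * B" by (simp add: distrib_right)
  finally show ?thesis .
qed

lemma initial_data_bound_critical:
  fixes D1 D2 p q :: real
  assumes D: "D1 > 0" "D2 > 0" and p: "p > 0" and q: "q > 0" and pq: "p * q > 1"
    and crit: "(q + 1) / (p * q - 1) = real DIM('a::euclidean_space) / 2"
  shows "\<exists>\<gamma>>0. \<forall>T (u :: 'a \<Rightarrow> real \<Rightarrow> ennreal) v \<mu> \<nu> \<sigma>.
    is_solution D1 D2 p q T u v \<longrightarrow> radon_measure \<mu> \<longrightarrow> radon_measure \<nu> \<longrightarrow>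
    has_initial_trace u \<mu> \<longrightarrow> has_initial_trace v \<nu> \<longrightarrow> 0 < \<sigma> \<and> \<sigma> \<le> sqrt T \<longrightarrow>
    (SUP x. \<integral>\<^sup>+\<tau>\<in>{0<..<\<sigma>}. ennreal (1 / \<tau>) *
        ennpowr (emeasure \<mu> (ball x \<tau>) / ennreal (\<tau> powr (real DIM('a) - (real DIM('a) + 2) / q))) q \<partial>lborel)
      + (SUP x. emeasure \<nu> (ball x \<sigma>))
    \<le> ennreal (\<gamma> * ln (exp 1 + sqrt T / \<sigma>) powr (- 1 / (p * q - 1)))"
proof -
  obtain C where C: "C > 0" and bound: "\<And>T (u :: 'a \<Rightarrow> real \<Rightarrow> ennreal) v z \<sigma> m.
    supersolution D1 p T u v \<Longrightarrow> supersolution D2 q T v u \<Longrightarrow> 0 < \<sigma> \<Longrightarrow> \<sigma> \<le> sqrt T \<Longrightarrow> 0 < m \<Longrightarrow>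
    lower_bound_on_balls z (\<sigma>\<^sup>2 / 16) T sqrt (\<lambda>t. m * t powr (- real DIM('a) / 2)) v \<Longrightarrow>
    m \<le> C * ln (exp 1 + sqrt T / \<sigma>) powr (- 1 / (p * q - 1))"
    using critical_mass_bound[OF assms] by blast
  define k where "k = 1 / source_const DIM('a) D1 D2 q + 1 / trace_const DIM('a) D2 9"
  have k: "k > 0" using D by (simp add: k_def source_const_pos trace_const_pos add_pos_pos)
  show ?thesis
  proof (intro exI[of _ "k * C"] conjI allI impI)
    fix T and u v :: "'a \<Rightarrow> real \<Rightarrow> ennreal" and \<mu> \<nu> \<sigma>
    assume sol: "is_solution D1 D2 p q T u v" and radon: "radon_measure \<mu>" "radon_measure \<nu>"
      and trace: "has_initial_trace u \<mu>" "has_initial_trace v \<nu>" and \<sigma>: "0 < \<sigma> \<and> \<sigma> \<le> sqrt T"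
    note sup = solution_imp_supersolution[OF sol]
    have "(SUP x. \<integral>\<^sup>+\<tau>\<in>{0<..<\<sigma>}. ennreal (1 / \<tau>) *
        ennpowr (emeasure \<mu> (ball x \<tau>) / ennreal (\<tau> powr (real DIM('a) - (real DIM('a) + 2) / q))) q \<partial>lborel)
      + (SUP x. emeasure \<nu> (ball x \<sigma>))
      \<le> ennreal (k * (C * ln (exp 1 + sqrt T / \<sigma>) powr (- 1 / (p * q - 1))))"
      unfolding k_def
      by (rule initial_data_le[OF sup D q trace(1) radon(1) trace(2) radon(2)])
        (use \<sigma> C bound[OF sup] in auto)
    then show "(SUP x. \<integral>\<^sup>+\<tau>\<in>{0<..<\<sigma>}. ennreal (1 / \<tau>) *
        ennpowr (emeasure \<mu> (ball x \<tau>) / ennreal (\<tau> powr (real DIM('a) - (real DIM('a) + 2) / q))) q \<partial>lborel)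
      + (SUP x. emeasure \<nu> (ball x \<sigma>))
      \<le> ennreal (k * C * ln (exp 1 + sqrt T / \<sigma>) powr (- 1 / (p * q - 1)))"
      by (simp only: mult.assoc)
  qed (use k C in auto)
qed

lemma initial_data_bound_equal_exponents:
  fixes D1 D2 q :: real
  assumes D: "D1 > 0" "D2 > 0" and q: "q > 0" and pq: "q * q > 1"
    and crit: "(q + 1) / (q * q - 1) = real DIM('a::euclidean_space) / 2"
  shows "\<exists>\<gamma>>0. \<forall>T (u :: 'a \<Rightarrow> real \<Rightarrow> ennreal) v \<mu> \<nu> \<sigma>.
    is_solution D1 D2 q q T u v \<longrightarrow> radon_measure \<mu> \<longrightarrow> radon_measure \<nu> \<longrightarrow>
    has_initial_trace u \<mu> \<longrightarrow> has_initial_trace v \<nu> \<longrightarrow> 0 < \<sigma> \<and> \<sigma> \<le> sqrt T \<longrightarrow>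
    (SUP x. emeasure \<mu> (ball x \<sigma>)) + (SUP x. emeasure \<nu> (ball x \<sigma>))
    \<le> ennreal (\<gamma> * ln (exp 1 + sqrt T / \<sigma>) powr (- real DIM('a) / 2))"
proof -
  obtain C1 where C1: "C1 > 0" and bound1: "\<And>T (u :: 'a \<Rightarrow> real \<Rightarrow> ennreal) v z \<sigma> m.
    supersolution D2 q T v u \<Longrightarrow> supersolution D1 q T u v \<Longrightarrow> 0 < \<sigma> \<Longrightarrow> \<sigma> \<le> sqrt T \<Longrightarrow> 0 < m \<Longrightarrow>
    lower_bound_on_balls z (\<sigma>\<^sup>2 / 16) T sqrt (\<lambda>t. m * t powr (- real DIM('a) / 2)) u \<Longrightarrow>
    m \<le> C1 * ln (exp 1 + sqrt T / \<sigma>) powr (- real DIM('a) / 2)"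
    using critical_mass_bound_equal_exponents[OF D(2) D(1) q pq crit] by blast
  obtain C2 where C2: "C2 > 0" and bound2: "\<And>T (u :: 'a \<Rightarrow> real \<Rightarrow> ennreal) v z \<sigma> m.
    supersolution D1 q T u v \<Longrightarrow> supersolution D2 q T v u \<Longrightarrow> 0 < \<sigma> \<Longrightarrow> \<sigma> \<le> sqrt T \<Longrightarrow> 0 < m \<Longrightarrow>
    lower_bound_on_balls z (\<sigma>\<^sup>2 / 16) T sqrt (\<lambda>t. m * t powr (- real DIM('a) / 2)) v \<Longrightarrow>
    m \<le> C2 * ln (exp 1 + sqrt T / \<sigma>) powr (- real DIM('a) / 2)"
    using critical_mass_bound_equal_exponents[OF D q pq crit] by blast
  define k1 where "k1 = trace_const DIM('a) D1 9"
  define k2 where "k2 = trace_const DIM('a) D2 9"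
  have k: "k1 > 0" "k2 > 0" using D by (auto simp: k1_def k2_def trace_const_pos)
  show ?thesis
  proof (intro exI[of _ "C1 / k1 + C2 / k2"] conjI allI impI)
    fix T and u v :: "'a \<Rightarrow> real \<Rightarrow> ennreal" and \<mu> \<nu> \<sigma>
    assume sol: "is_solution D1 D2 q q T u v" and radon: "radon_measure \<mu>" "radon_measure \<nu>"
      and trace: "has_initial_trace u \<mu>" "has_initial_trace v \<nu>" and \<sigma>: "0 < \<sigma> \<and> \<sigma> \<le> sqrt T"
    note sup = solution_imp_supersolution[OF sol]
    let ?L = "ln (exp 1 + sqrt T / \<sigma>) powr (- real DIM('a) / 2)"
    have "(SUP x. emeasure \<mu> (ball x \<sigma>)) \<le> ennreal (C1 * ?L / k1)"
      unfolding k1_def using \<sigma> bound1[OF sup(2) sup(1)]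
      by (intro initial_mass_le[OF sup(1) D(1) trace(1) radon(1)]) auto
    moreover have "(SUP x. emeasure \<nu> (ball x \<sigma>)) \<le> ennreal (C2 * ?L / k2)"
      unfolding k2_def using \<sigma> bound2[OF sup]
      by (intro initial_mass_le[OF sup(2) D(2) trace(2) radon(2)]) auto
    ultimately have "(SUP x. emeasure \<mu> (ball x \<sigma>)) + (SUP x. emeasure \<nu> (ball x \<sigma>))
        \<le> ennreal (C1 * ?L / k1) + ennreal (C2 * ?L / k2)" by (rule add_mono)
    also have "\<dots> = ennreal (C1 * ?L / k1 + C2 * ?L / k2)"
      using C1 C2 k by (simp add: ennreal_plus)
    also have "C1 * ?L / k1 + C2 * ?L / k2 = (C1 / k1 + C2 / k2) * ?L" by (simp add: distrib_right)
    finally show "(SUP x. emeasure \<mu> (ball x \<sigma>)) + (SUP x. emeasure \<nu> (ball x \<sigma>))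
        \<le> ennreal ((C1 / k1 + C2 / k2) * ?L)" .
  qed (use C1 C2 k in \<open>auto intro: add_pos_pos\<close>)
qed

lemma initial_data_bound:
  fixes D1 D2 p q :: real
  assumes D: "D1 > 0" "D2 > 0" and p: "p > 0" and q: "q > 0" and pq: "p * q > 1"
  shows "\<exists>\<gamma>>0. \<forall>T (u :: 'a::euclidean_space \<Rightarrow> real \<Rightarrow> ennreal) v \<mu> \<nu>.
    0 < T \<longrightarrow> is_solution D1 D2 p q T u v \<longrightarrow> radon_measure \<mu> \<longrightarrow> radon_measure \<nu> \<longrightarrow>
    has_initial_trace u \<mu> \<longrightarrow> has_initial_trace v \<nu> \<longrightarrow>
    (SUP x. \<integral>\<^sup>+\<tau>\<in>{0<..<sqrt T}. ennreal (1 / \<tau>) *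
        ennpowr (emeasure \<mu> (ball x \<tau>) / ennreal (\<tau> powr (real DIM('a) - (real DIM('a) + 2) / q))) q \<partial>lborel)
      + (SUP x. emeasure \<nu> (ball x (sqrt T)))
    \<le> ennreal (\<gamma> * T powr (real DIM('a) / 2 - (q + 1) / (p * q - 1)))"
proof -
  obtain C where C: "C > 0" and bound: "\<And>T (u :: 'a \<Rightarrow> real \<Rightarrow> ennreal) v z a m.
    supersolution D1 p T u v \<Longrightarrow> supersolution D2 q T v u \<Longrightarrow> 0 < T \<Longrightarrow> a \<le> T / 2 \<Longrightarrow> 0 < m \<Longrightarrow>
    lower_bound_on_balls z a T sqrt (\<lambda>t. m * t powr (- real DIM('a) / 2)) v \<Longrightarrow>
    m \<le> C * T powr (real DIM('a) / 2 - (q + 1) / (p * q - 1))"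
    using mass_bound[OF assms, where 'a = 'a] by blast
  define k where "k = 1 / source_const DIM('a) D1 D2 q + 1 / trace_const DIM('a) D2 9"
  have k: "k > 0" using D by (simp add: k_def source_const_pos trace_const_pos add_pos_pos)
  show ?thesis
  proof (intro exI[of _ "k * C"] conjI allI impI)
    fix T and u v :: "'a \<Rightarrow> real \<Rightarrow> ennreal" and \<mu> \<nu>
    assume T: "0 < T" and sol: "is_solution D1 D2 p q T u v" and radon: "radon_measure \<mu>" "radon_measure \<nu>"
      and trace: "has_initial_trace u \<mu>" "has_initial_trace v \<nu>"
    note sup = solution_imp_supersolution[OF sol]
    have "(SUP x. \<integral>\<^sup>+\<tau>\<in>{0<..<sqrt T}. ennreal (1 / \<tau>) *
        ennpowr (emeasure \<mu> (ball x \<tau>) / ennreal (\<tau> powr (real DIM('a) - (real DIM('a) + 2) / q))) q \<partial>lborel)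
      + (SUP x. emeasure \<nu> (ball x (sqrt T)))
      \<le> ennreal (k * (C * T powr (real DIM('a) / 2 - (q + 1) / (p * q - 1))))"
      unfolding k_def
      by (rule initial_data_le[OF sup D q trace(1) radon(1) trace(2) radon(2)])
        (use T C bound[OF sup T, where a = "T / 16"] in auto)
    then show "(SUP x. \<integral>\<^sup>+\<tau>\<in>{0<..<sqrt T}. ennreal (1 / \<tau>) *
        ennpowr (emeasure \<mu> (ball x \<tau>) / ennreal (\<tau> powr (real DIM('a) - (real DIM('a) + 2) / q))) q \<partial>lborel)
      + (SUP x. emeasure \<nu> (ball x (sqrt T)))
      \<le> ennreal (k * C * T powr (real DIM('a) / 2 - (q + 1) / (p * q - 1)))"
      by (simp only: mult.assoc)
  qed (use k C in auto)
qed

text \<open>Reconciles the two forms of the weight: in the critical case the general exponent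
  \<open>(N + 2) / q\<close> is the scaling exponent \<open>2 (p + 1) / (p q - 1)\<close> of \<open>u\<close>.\<close>

lemma critical_exponent_identity:
  fixes N p q :: real
  assumes "(q + 1) / (p * q - 1) = N / 2" and "p * q > 1" and "q > 0"
  shows "2 * (p + 1) / (p * q - 1) = (N + 2) / q"
proof -
  have "N + 2 = 2 * ((q + 1) / (p * q - 1)) + 2" unfolding assms(1) by simp
  also have "\<dots> = q * (2 * (p + 1) / (p * q - 1))"
    using assms(2) by (simp add: field_simps)
  finally show ?thesis using assms(3) by simp
qed

theorem theorem1p3:
  fixes D1 D2 p q :: real
  assumes "D1 > 0" and "D2 > 0" and "0 < p" and "p \<le> q" and "p * q > 1"
  shows "\<exists>\<gamma>B \<gamma>C \<gamma>D \<gamma>E :: real. \<gamma>B > 0 \<and> \<gamma>C > 0 \<and> \<gamma>D > 0 \<and> \<gamma>E > 0 \<and>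
    (\<forall>(T::real) (u :: real ^ 'n \<Rightarrow> real \<Rightarrow> ennreal) (v :: real ^ 'n \<Rightarrow> real \<Rightarrow> ennreal)
      (\<mu> :: (real ^ 'n) measure) (\<nu> :: (real ^ 'n) measure).
      0 < T \<longrightarrow> is_solution D1 D2 p q T u v \<longrightarrow>
      radon_measure \<mu> \<longrightarrow> radon_measure \<nu> \<longrightarrow>
      has_initial_trace u \<mu> \<longrightarrow> has_initial_trace v \<nu> \<longrightarrow>
      ((q + 1) / (p * q - 1) = real CARD('n) / 2 \<and> p < q \<longrightarrow>
        (\<forall>\<sigma>. 0 < \<sigma> \<and> \<sigma> \<le> sqrt T \<longrightarrow>
          (SUP x. \<integral>\<^sup>+ \<tau>\<in>{0<..<\<sigma>}. ennreal (1 / \<tau>) *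
              ennpowr (emeasure \<mu> (ball x \<tau>) /
                ennreal (\<tau> powr (real CARD('n) - 2 * (p + 1) / (p * q - 1)))) q \<partial>lborel)
          + (SUP x. emeasure \<nu> (ball x \<sigma>))
          \<le> ennreal (\<gamma>B * ln (exp 1 + sqrt T / \<sigma>) powr (- 1 / (p * q - 1))))) \<and>
      ((q + 1) / (p * q - 1) = real CARD('n) / 2 \<and> p = q \<longrightarrow>
        (\<forall>\<sigma>. 0 < \<sigma> \<and> \<sigma> \<le> sqrt T \<longrightarrow>
          (SUP x. emeasure \<mu> (ball x \<sigma>)) + (SUP x. emeasure \<nu> (ball x \<sigma>))
          \<le> ennreal (\<gamma>C * ln (exp 1 + sqrt T / \<sigma>) powr (- real CARD('n) / 2)))) \<and>
      ((q + 1) / (p * q - 1) > real CARD('n) / 2 \<and> q > 1 + 2 / real CARD('n) \<longrightarrow>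
          (SUP x. \<integral>\<^sup>+ \<tau>\<in>{0<..<sqrt T}. ennreal (1 / \<tau>) *
              ennpowr (emeasure \<mu> (ball x \<tau>) /
                ennreal (\<tau> powr (real CARD('n) - (real CARD('n) + 2) / q))) q \<partial>lborel)
          + (SUP x. emeasure \<nu> (ball x (sqrt T)))
          \<le> ennreal (\<gamma>D * T powr (real CARD('n) / 2 - (q + 1) / (p * q - 1)))) \<and>
      ((q + 1) / (p * q - 1) > real CARD('n) / 2 \<and> q = 1 + 2 / real CARD('n) \<longrightarrow>
          (SUP x. \<integral>\<^sup>+ \<tau>\<in>{0<..<sqrt T}. ennreal (1 / \<tau>) *
              ennpowr (emeasure \<mu> (ball x \<tau>)) q \<partial>lborel)
          + (SUP x. emeasure \<nu> (ball x (sqrt T)))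
          \<le> ennreal (\<gamma>E * T powr (real CARD('n) / 2 - (q + 1) / (p * q - 1)))))"
proof -
  let ?N = "real CARD('n)"
  have N: "real DIM(real ^ 'n) = ?N" by simp
  have q: "q > 0" using assms by simp
  let ?profile = "\<lambda>(\<mu> :: (real ^ 'n) measure) \<sigma>. SUP x. \<integral>\<^sup>+\<tau>\<in>{0<..<\<sigma>}. ennreal (1 / \<tau>) *
      ennpowr (emeasure \<mu> (ball x \<tau>) / ennreal (\<tau> powr (?N - (?N + 2) / q))) q \<partial>lborel"
  have "\<exists>\<gamma>>0. (q + 1) / (p * q - 1) = ?N / 2 \<longrightarrow>
    (\<forall>T (u :: real ^ 'n \<Rightarrow> real \<Rightarrow> ennreal) v \<mu> \<nu> \<sigma>.
      is_solution D1 D2 p q T u v \<longrightarrow> radon_measure \<mu> \<longrightarrow> radon_measure \<nu> \<longrightarrow>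
      has_initial_trace u \<mu> \<longrightarrow> has_initial_trace v \<nu> \<longrightarrow> 0 < \<sigma> \<and> \<sigma> \<le> sqrt T \<longrightarrow>
      ?profile \<mu> \<sigma> + (SUP x. emeasure \<nu> (ball x \<sigma>))
        \<le> ennreal (\<gamma> * ln (exp 1 + sqrt T / \<sigma>) powr (- 1 / (p * q - 1))))"
  proof (cases "(q + 1) / (p * q - 1) = ?N / 2")
    case True
    then show ?thesis
      using initial_data_bound_critical[where 'a = "real ^ 'n", OF assms(1-3) q assms(5)] unfolding N by blast
  next
    case False
    then show ?thesis by (intro exI[of _ 1]) simp
  qed
  then obtain \<gamma>B where \<gamma>B: "\<gamma>B > 0" and B: "\<And>T (u :: real ^ 'n \<Rightarrow> real \<Rightarrow> ennreal) v \<mu> \<nu> \<sigma>.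
      (q + 1) / (p * q - 1) = ?N / 2 \<Longrightarrow>
      is_solution D1 D2 p q T u v \<Longrightarrow> radon_measure \<mu> \<Longrightarrow> radon_measure \<nu> \<Longrightarrow>
      has_initial_trace u \<mu> \<Longrightarrow> has_initial_trace v \<nu> \<Longrightarrow> 0 < \<sigma> \<and> \<sigma> \<le> sqrt T \<Longrightarrow>
      ?profile \<mu> \<sigma> + (SUP x. emeasure \<nu> (ball x \<sigma>))
        \<le> ennreal (\<gamma>B * ln (exp 1 + sqrt T / \<sigma>) powr (- 1 / (p * q - 1)))"
    by blast
  have "\<exists>\<gamma>>0. (q + 1) / (p * q - 1) = ?N / 2 \<and> p = q \<longrightarrow>
    (\<forall>T (u :: real ^ 'n \<Rightarrow> real \<Rightarrow> ennreal) v \<mu> \<nu> \<sigma>.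
      is_solution D1 D2 p q T u v \<longrightarrow> radon_measure \<mu> \<longrightarrow> radon_measure \<nu> \<longrightarrow>
      has_initial_trace u \<mu> \<longrightarrow> has_initial_trace v \<nu> \<longrightarrow> 0 < \<sigma> \<and> \<sigma> \<le> sqrt T \<longrightarrow>
      (SUP x. emeasure \<mu> (ball x \<sigma>)) + (SUP x. emeasure \<nu> (ball x \<sigma>))
        \<le> ennreal (\<gamma> * ln (exp 1 + sqrt T / \<sigma>) powr (- ?N / 2)))"
  proof (cases "(q + 1) / (p * q - 1) = ?N / 2 \<and> p = q")
    case True
    then have pq: "q * q > 1" "(q + 1) / (q * q - 1) = ?N / 2" "p = q" using assms by auto
    show ?thesis
      using initial_data_bound_equal_exponents[where 'a = "real ^ 'n", OF assms(1-2) q pq(1)] pq(2)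
      unfolding N pq(3) by blast
  next
    case False
    show ?thesis by (rule exI[of _ 1], intro conjI impI, simp, use False in blast)
  qed
  then obtain \<gamma>C where \<gamma>C: "\<gamma>C > 0" and C: "\<And>T (u :: real ^ 'n \<Rightarrow> real \<Rightarrow> ennreal) v \<mu> \<nu> \<sigma>.
      (q + 1) / (p * q - 1) = ?N / 2 \<Longrightarrow> p = q \<Longrightarrow>
      is_solution D1 D2 p q T u v \<Longrightarrow> radon_measure \<mu> \<Longrightarrow> radon_measure \<nu> \<Longrightarrow>
      has_initial_trace u \<mu> \<Longrightarrow> has_initial_trace v \<nu> \<Longrightarrow> 0 < \<sigma> \<and> \<sigma> \<le> sqrt T \<Longrightarrow>
      (SUP x. emeasure \<mu> (ball x \<sigma>)) + (SUP x. emeasure \<nu> (ball x \<sigma>))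
        \<le> ennreal (\<gamma>C * ln (exp 1 + sqrt T / \<sigma>) powr (- ?N / 2))"
    by blast
  obtain \<gamma>D where \<gamma>D: "\<gamma>D > 0" and Dd: "\<And>T (u :: real ^ 'n \<Rightarrow> real \<Rightarrow> ennreal) v \<mu> \<nu>.
      0 < T \<Longrightarrow> is_solution D1 D2 p q T u v \<Longrightarrow> radon_measure \<mu> \<Longrightarrow> radon_measure \<nu> \<Longrightarrow>
      has_initial_trace u \<mu> \<Longrightarrow> has_initial_trace v \<nu> \<Longrightarrow>
      ?profile \<mu> (sqrt T) + (SUP x. emeasure \<nu> (ball x (sqrt T)))
        \<le> ennreal (\<gamma>D * T powr (?N / 2 - (q + 1) / (p * q - 1)))"
    using initial_data_bound[where 'a = "real ^ 'n", OF assms(1-3) q assms(5)] unfolding N by blast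
  show ?thesis
  proof (rule exI[of _ \<gamma>B], rule exI[of _ \<gamma>C], rule exI[of _ \<gamma>D], rule exI[of _ \<gamma>D],
      intro conjI allI impI \<gamma>B \<gamma>C \<gamma>D)
    fix T and u v :: "real ^ 'n \<Rightarrow> real \<Rightarrow> ennreal" and \<mu> \<nu>
    assume T: "0 < T" and sol: "is_solution D1 D2 p q T u v" and radon: "radon_measure \<mu>" "radon_measure \<nu>"
      and trace: "has_initial_trace u \<mu>" "has_initial_trace v \<nu>"
    show "(SUP x. \<integral>\<^sup>+\<tau>\<in>{0<..<\<sigma>}. ennreal (1 / \<tau>) *
              ennpowr (emeasure \<mu> (ball x \<tau>) / ennreal (\<tau> powr (?N - 2 * (p + 1) / (p * q - 1)))) q \<partial>lborel)
          + (SUP x. emeasure \<nu> (ball x \<sigma>))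
          \<le> ennreal (\<gamma>B * ln (exp 1 + sqrt T / \<sigma>) powr (- 1 / (p * q - 1)))"
      if "(q + 1) / (p * q - 1) = ?N / 2 \<and> p < q" and "0 < \<sigma> \<and> \<sigma> \<le> sqrt T" for \<sigma>
      using B[OF _ sol radon trace that(2)] that(1) critical_exponent_identity[of q p ?N] assms(5) q
      by simp
    show "(SUP x. emeasure \<mu> (ball x \<sigma>)) + (SUP x. emeasure \<nu> (ball x \<sigma>))
          \<le> ennreal (\<gamma>C * ln (exp 1 + sqrt T / \<sigma>) powr (- ?N / 2))"
      if "(q + 1) / (p * q - 1) = ?N / 2 \<and> p = q" and "0 < \<sigma> \<and> \<sigma> \<le> sqrt T" for \<sigma>
      by (rule C[OF conjunct1[OF that(1)] conjunct2[OF that(1)] sol radon trace that(2)])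
    show main: "?profile \<mu> (sqrt T) + (SUP x. emeasure \<nu> (ball x (sqrt T)))
          \<le> ennreal (\<gamma>D * T powr (?N / 2 - (q + 1) / (p * q - 1)))"
      using Dd[OF T sol radon trace] .
    show "(SUP x. \<integral>\<^sup>+\<tau>\<in>{0<..<sqrt T}. ennreal (1 / \<tau>) * ennpowr (emeasure \<mu> (ball x \<tau>)) q \<partial>lborel)
          + (SUP x. emeasure \<nu> (ball x (sqrt T)))
          \<le> ennreal (\<gamma>D * T powr (?N / 2 - (q + 1) / (p * q - 1)))"
      if h: "(q + 1) / (p * q - 1) > ?N / 2 \<and> q = 1 + 2 / ?N"
    proof -
      have "?N > 0" by simp
      then have "?N + 2 = ?N * q" using h by (simp add: field_simps)
      then have "(?N + 2) / q = ?N" using q by simp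
      then have zero: "?N - (?N + 2) / q = 0" by simp
      have "(\<integral>\<^sup>+\<tau>\<in>{0<..<sqrt T}. ennreal (1 / \<tau>) *
          ennpowr (emeasure \<mu> (ball x \<tau>) / ennreal (\<tau> powr (?N - (?N + 2) / q))) q \<partial>lborel)
        = (\<integral>\<^sup>+\<tau>\<in>{0<..<sqrt T}. ennreal (1 / \<tau>) * ennpowr (emeasure \<mu> (ball x \<tau>)) q \<partial>lborel)" for x
        unfolding zero by (rule nn_integral_cong) (simp add: divide_ennreal_def split: split_indicator)
      then show ?thesis using Dd[OF T sol radon trace] by simp
    qed
  qed
qed

end
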